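(* Let $P_n(z) = \sum_{k=0}^n a_k z^k$ be a nonzero polynomial with integer coefficients. If $P_n$ has at least one zero in $\mathbb{D}$, then $\|P_n\|_0$ is a transcendental number. Otherwise, $\|P_n\|_0=M(P_n)=|a_0|$ is an integer.
   Context: $\mathbb{D}=\{z\in\mathbb{C}:|z|<1\}$ is the open unit disk and $dA$ is the area (Lebesgue) measure. For a nonzero polynomial $P$ with complex coefficients, Mahler's measure is $$M(P) := \exp\left(\frac{1}{2\pi}\int_0^{2\pi}\log|P(e^{i\theta})|\,d\theta\right),$$ and its areal analog is $$\|P\|_0 := \exp\left(\frac{1}{\pi}\iint_{\mathbb{D}}\log|P(z)|\,dA\right).$$ *)

theory Defs
  imports "HOL-Analysis.Analysis" "HOL-Computational_Algebra.Polynomial"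
begin

(* Both measures are meant for nonzero P.  Then log |P| is integrable on the circle and on the disk,
   and the convention ln 0 = 0 only changes the integrands at the finitely many zeros of P. *)

definition mahler :: "complex poly \<Rightarrow> real" where
  "mahler P = exp (1 / (2 * pi) * (LBINT \<theta>:{0..2 * pi}. ln (cmod (poly P (exp (\<i> * of_real \<theta>))))))"

(* lborel on the Euclidean space complex is area measure. *)
definition areal_mahler :: "complex poly \<Rightarrow> real" where
  "areal_mahler P = exp (1 / pi * (LBINT z:ball (0::complex) 1. ln (cmod (poly P z))))"

end

theory Submission
  imports Defs "HOL-Real_Asymp.Real_Asymp" "HOL-Computational_Algebra.Fundamental_Theorem_Algebra"
begin

text \<open>
  By Jensen's formula on the circle, $M(P) = |c| \prod_j \max(1, |a_j|)$ for $P = c \prod_j (z - a_j)$, and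
  averaging $\log |z - a|$ over the rotations of the disk gives
  $\|P\|_0 = M(P) \exp \bigl(\sum_{|a_j| < 1} (|a_j|^2 - 1) / 2\bigr)$. If some root lies in the disk, the exponent
  is a nonzero real algebraic number while $M(P)$ is algebraic and nonzero, so $\|P\|_0$ is
  transcendental by the Hermite--Lindemann theorem for real exponents.

  Hermite--Lindemann is proved by an auxiliary function
  $F(x) = \sum_{j < q} A_j(x) e^{jx}$, with integer polynomials $A_j$ of degree less than $n$ chosen by Siegel's lemma
  so that $F$ vanishes to order at least $n q / 2$ at $0$. Compare the exact order $m$ of $F$ at $0$ with its
  order at $\alpha$. If the latter exceeds $m$, the nonzero integer $F^{(m)}(0)$ is less than $1$ in absolute value; otherwise the
  first nonvanishing derivative at $\alpha$ is a polynomial in $\alpha$ and $e^\alpha$ violating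
  Liouville's inequality. Siegel's lemma also yields Liouville's inequality and the closure of
  algebraic numbers under sums and products: the powers of a number acting on a finitely generated subgroup
  satisfy a small integer relation, so neither conjugates nor symmetric functions are needed.
\<close>

subsection \<open>Siegel's lemma and algebraic numbers\<close>

text \<open>Siegel's lemma forces zeros at 0 but gives no upper bound for their number. The exact
  order m replaces a zero estimate, so the final comparison must hold for every m at least M = n q /
  2, however large. Everything is weighed against m!. The gain: a zero of order m at one point
  contributes a factor 1/m! at the other. Since the exponent is real, repeated use of Rolle's
  theorem gives this, in place of Schwarz's lemma. The loss: the auxiliary polynomials cost n!^2,
  one factor from the entries of the linear system and one from measuring coefficients with the
  weights i!; Liouville's inequality raises this to the power D + 1. Thus m! competes with G^m
  n!^(2D+2), and m at least n (2D + 3) suffices for a suitable n. Here D depends only on the two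
  numbers supposed algebraic, so q = 2 (2D + 3) can be fixed before n. On the analytic side the
  obstacle is that log |z - a| is unbounded below and not yet known to be integrable. Subtracting it
  from an upper bound makes it nonnegative, so that Fatou and Tonelli apply first and integrability
  follows.\<close>

lemma siegel_int:
  fixes A :: "'i \<Rightarrow> 'j \<Rightarrow> int" and B :: nat
  assumes fin: "finite I" "finite J" and J: "J \<noteq> {}" and card: "2 * card I \<le> card J"
    and bound: "\<And>i j. i \<in> I \<Longrightarrow> j \<in> J \<Longrightarrow> \<bar>A i j\<bar> \<le> int B" and B: "B \<ge> 1"
  shows "\<exists>x. (\<forall>j\<in>J. \<bar>x j\<bar> \<le> int (card J * B)) \<and> (\<exists>j\<in>J. x j \<noteq> 0) \<and>
             (\<forall>i\<in>I. (\<Sum>j\<in>J. A i j * x j) = 0)"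
proof -
  \<comment> \<open>Dirichlet's box principle. On vectors with entries in 0..X each form takes
    values in an interval of length card J * B * X = X * X starting at \<open>L i\<close>. Since X^2
    + 1 < (X + 1)^2, having twice as many unknowns as equations gives more vectors than
    values.\<close>
  define X where "X = card J * B"
  define L where "L i = (\<Sum>j\<in>J. min 0 (A i j) * int X)" for i
  define S where "S = J \<rightarrow>\<^sub>E {0..int X}"
  define T where "T = (\<Pi>\<^sub>E i\<in>I. {L i..L i + int (X * X)})"
  define \<Phi> where "\<Phi> x = (\<lambda>i\<in>I. \<Sum>j\<in>J. A i j * x j)" for x :: "'j \<Rightarrow> int"
  have cJ: "card J \<ge> 1" using fin J by (simp add: Suc_leI card_gt_0_iff)
  have X1: "X \<ge> 1" unfolding X_def using mult_le_mono[OF cJ B] by simp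
  have "card T = (X * X + 1) ^ card I"
    unfolding T_def using fin by (subst card_PiE) (auto simp: nat_add_distrib simp flip: of_nat_mult)
  moreover have "card S = (X + 1) ^ card J"
    unfolding S_def using fin by (subst card_PiE) (auto simp: nat_add_distrib)
  moreover have "(X * X + 1) ^ card I < (X + 1) ^ card J"
  proof (cases "card I = 0")
    case True
    then show ?thesis using cJ X1 one_less_power[of "X + 1" "card J"] by simp
  next
    case False
    have "(X * X + 1) ^ card I < ((X + 1) ^ 2) ^ card I"
      using False X1 by (intro power_strict_mono) (auto simp: power2_eq_square)
    also have "\<dots> \<le> (X + 1) ^ card J"
      using card by (simp flip: power_mult add: power_increasing del: add_Suc_right)
    finally show ?thesis .
  qed
  ultimately have less: "card T < card S" by simp
  have range: "\<Phi> ` S \<subseteq> T"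
  proof safe
    fix x assume x: "x \<in> S"
    have "(\<Sum>j\<in>J. A i j * x j) \<in> {L i..L i + int (X * X)}" if i: "i \<in> I" for i
    proof -
      have xj: "0 \<le> x j" "x j \<le> int X" if "j \<in> J" for j using x that by (auto simp: S_def)
      have 1: "L i \<le> (\<Sum>j\<in>J. A i j * x j)"
        unfolding L_def
      proof (intro sum_mono)
        fix j assume j: "j \<in> J"
        show "min 0 (A i j) * int X \<le> A i j * x j"
          using xj[OF j] by (cases "A i j \<ge> 0") (auto simp: min_def mult_left_mono_neg)
      qed
      have "(\<Sum>j\<in>J. A i j * x j) - L i = (\<Sum>j\<in>J. A i j * x j - min 0 (A i j) * int X)"
        by (simp add: L_def sum_subtractf)
      also have "\<dots> \<le> (\<Sum>j\<in>J. int B * int X)"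
      proof (intro sum_mono)
        fix j assume j: "j \<in> J"
        show "A i j * x j - min 0 (A i j) * int X \<le> int B * int X"
        proof (cases "A i j \<ge> 0")
          case True
          then have "A i j * x j \<le> int B * int X"
            using xj[OF j] bound[OF i j] by (intro mult_mono) auto
          then show ?thesis using True by simp
        next
          case False
          have "A i j * x j \<le> 0" using False xj[OF j] by (simp add: mult_nonpos_nonneg)
          moreover have "- A i j * int X \<le> int B * int X"
            using bound[OF i j] by (intro mult_right_mono) auto
          ultimately show ?thesis using False by simp
        qed
      qed
      also have "\<dots> = int (X * X)" by (simp add: X_def)
      finally show ?thesis using 1 by simp
    qed
    then show "\<Phi> x \<in> T" by (auto simp: \<Phi>_def T_def)
  qed
  have "finite T" unfolding T_def using fin by (intro finite_PiE) auto
  then have "card (\<Phi> ` S) < card S" using range less by (meson card_mono le_less_trans)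
  then have "\<not> inj_on \<Phi> S" using pigeonhole by blast
  then obtain x y where xy: "x \<in> S" "y \<in> S" "\<Phi> x = \<Phi> y" "x \<noteq> y" by (auto simp: inj_on_def)
  have "\<exists>j\<in>J. x j - y j \<noteq> 0"
    using xy unfolding S_def by (metis PiE_ext eq_iff_diff_eq_0)
  moreover have "(\<Sum>j\<in>J. A i j * (x j - y j)) = 0" if "i \<in> I" for i
    using fun_cong[OF xy(3), of i] that by (simp add: \<Phi>_def sum_subtractf right_diff_distrib)
  moreover have "\<bar>x j - y j\<bar> \<le> int (card J * B)" if "j \<in> J" for j
    using xy(1,2) that by (force simp: S_def X_def abs_le_iff)
  ultimately show ?thesis by (intro exI[of _ "\<lambda>j. x j - y j"]) blast
qed

text \<open>A set of values instead of a norm: the generators \<open>w\<close> may be dependent, so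
  an element can have many coefficient vectors, and only the existence of a bounded one is
  recorded.\<close>

definition int_ball :: "('i \<Rightarrow> 'a::field_char_0) \<Rightarrow> 'i set \<Rightarrow> real \<Rightarrow> 'a set" where
  "int_ball w I B = {\<Sum>i\<in>I. of_int (c i) * w i |c. \<forall>i\<in>I. \<bar>real_of_int (c i)\<bar> \<le> B}"

text \<open>Multiplication by \<open>y\<close> maps the $\mathbb{Z}$-span of \<open>w\<close> into itself, with operator norm at most
  \<open>R\<close> for the maximum norm of coefficients.\<close>

definition int_multiplier :: "('i \<Rightarrow> 'a::field_char_0) \<Rightarrow> 'i set \<Rightarrow> real \<Rightarrow> 'a \<Rightarrow> bool" where
  "int_multiplier w I R y \<longleftrightarrow> 0 \<le> R \<and> (\<forall>B x. x \<in> int_ball w I B \<longrightarrow> y * x \<in> int_ball w I (R * B))"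

lemma int_ballI:
  "(\<And>i. i \<in> I \<Longrightarrow> \<bar>real_of_int (c i)\<bar> \<le> B) \<Longrightarrow> (\<Sum>i\<in>I. of_int (c i) * w i) \<in> int_ball w I B"
  unfolding int_ball_def by blast

lemma int_ball_add:
  assumes "x \<in> int_ball w I B" "y \<in> int_ball w I B'"
  shows "x + y \<in> int_ball w I (B + B')"
proof -
  obtain c where c: "x = (\<Sum>i\<in>I. of_int (c i) * w i)" "\<And>i. i \<in> I \<Longrightarrow> \<bar>real_of_int (c i)\<bar> \<le> B"
    using assms(1) unfolding int_ball_def by blast
  obtain d where d: "y = (\<Sum>i\<in>I. of_int (d i) * w i)" "\<And>i. i \<in> I \<Longrightarrow> \<bar>real_of_int (d i)\<bar> \<le> B'"
    using assms(2) unfolding int_ball_def by blast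
  have "x + y = (\<Sum>i\<in>I. of_int (c i + d i) * w i)"
    by (simp add: c d sum.distrib distrib_right)
  moreover have "\<bar>real_of_int (c i + d i)\<bar> \<le> B + B'" if "i \<in> I" for i
    using c(2)[OF that] d(2)[OF that] by simp
  ultimately show ?thesis using int_ballI[of I "\<lambda>i. c i + d i"] by metis
qed

lemma int_ball_scale:
  assumes "x \<in> int_ball w I B"
  shows "of_int z * x \<in> int_ball w I (\<bar>real_of_int z\<bar> * B)"
proof -
  obtain c where c: "x = (\<Sum>i\<in>I. of_int (c i) * w i)" "\<And>i. i \<in> I \<Longrightarrow> \<bar>real_of_int (c i)\<bar> \<le> B"
    using assms(1) unfolding int_ball_def by blast
  have "of_int z * x = (\<Sum>i\<in>I. of_int (z * c i) * w i)"
    by (simp add: c sum_distrib_left mult.assoc)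
  moreover have "\<bar>real_of_int (z * c i)\<bar> \<le> \<bar>real_of_int z\<bar> * B" if "i \<in> I" for i
    using c(2)[OF that] by (simp add: abs_mult mult_left_mono)
  ultimately show ?thesis using int_ballI[of I "\<lambda>i. z * c i"] by metis
qed

lemma int_ball_mono: "x \<in> int_ball w I B \<Longrightarrow> B \<le> B' \<Longrightarrow> x \<in> int_ball w I B'"
  unfolding int_ball_def by force

lemma int_ball_zero: "0 \<le> B \<Longrightarrow> 0 \<in> int_ball w I B"
  using int_ballI[of I "\<lambda>_. 0" B w] by simp

lemma int_ball_sum:
  assumes "finite K" "\<And>k. k \<in> K \<Longrightarrow> x k \<in> int_ball w I (B k)"
  shows "(\<Sum>k\<in>K. x k) \<in> int_ball w I (\<Sum>k\<in>K. B k)"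
  using assms by (induction K rule: finite_induct) (auto intro: int_ball_add int_ball_zero)

lemma int_ball_basis:
  assumes "finite I" "i \<in> I"
  shows "w i \<in> int_ball w I 1"
proof -
  have "(\<Sum>k\<in>I. of_int (if k = i then 1 else 0) * w k) = (\<Sum>k\<in>I. if k = i then w k else 0)"
    by (intro sum.cong) auto
  also have "\<dots> = w i" using assms by simp
  finally show ?thesis using int_ballI[of I "\<lambda>k. if k = i then 1 else 0" 1 w] by simp
qed

text \<open>It is enough to bound the images of the generators; the factor \<open>card I\<close> is
  the price of adding one ball for each of them.\<close>

lemma int_multiplierI:
  fixes R :: real
  assumes "finite I" "0 \<le> R" "\<And>i. i \<in> I \<Longrightarrow> y * w i \<in> int_ball w I R"
  shows "int_multiplier w I (card I * R) y"
  unfolding int_multiplier_def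
proof (intro conjI allI impI)
  fix B x assume "x \<in> int_ball w I B"
  then obtain c where c: "x = (\<Sum>i\<in>I. of_int (c i) * w i)" "\<And>i. i \<in> I \<Longrightarrow> \<bar>real_of_int (c i)\<bar> \<le> B"
    unfolding int_ball_def by blast
  have "(\<Sum>i\<in>I. of_int (c i) * (y * w i)) \<in> int_ball w I (\<Sum>i\<in>I. R * B)"
  proof (rule int_ball_sum[OF assms(1)])
    fix i assume i: "i \<in> I"
    have "of_int (c i) * (y * w i) \<in> int_ball w I (\<bar>real_of_int (c i)\<bar> * R)"
      using assms(3)[OF i] by (rule int_ball_scale)
    then show "of_int (c i) * (y * w i) \<in> int_ball w I (R * B)"
      by (rule int_ball_mono) (use mult_left_mono[OF c(2)[OF i] assms(2)] in \<open>simp add: mult.commute\<close>)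
  qed
  then show "y * x \<in> int_ball w I (card I * R * B)"
    by (simp add: c sum_distrib_left mult_ac)
qed (use assms in auto)

lemma int_multiplier_mult:
  assumes "int_multiplier w I R y" "int_multiplier w I R' y'"
  shows "int_multiplier w I (R * R') (y * y')"
  using assms unfolding int_multiplier_def by (auto simp: mult.assoc)

lemma int_multiplier_add:
  assumes "int_multiplier w I R y" "int_multiplier w I R' y'"
  shows "int_multiplier w I (R + R') (y + y')"
  using assms unfolding int_multiplier_def by (auto simp: distrib_right intro!: int_ball_add)

lemma int_multiplier_of_int: "int_multiplier w I \<bar>real_of_int z\<bar> (of_int z)"
  unfolding int_multiplier_def by (auto intro: int_ball_scale)

lemma int_multiplier_power: "int_multiplier w I R y \<Longrightarrow> int_multiplier w I (R ^ k) (y ^ k)"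
  using int_multiplier_of_int[of w I 1] by (induction k) (auto intro: int_multiplier_mult)

lemma int_multiplier_sum:
  assumes "finite K" "\<And>k. k \<in> K \<Longrightarrow> int_multiplier w I (R k) (y k)"
  shows "int_multiplier w I (\<Sum>k\<in>K. R k) (\<Sum>k\<in>K. y k)"
  using assms int_multiplier_of_int[of w I 0]
  by (induction K rule: finite_induct) (auto intro: int_multiplier_add)

lemma int_multiplier_mono:
  assumes "int_multiplier w I R y" "R \<le> R'"
  shows "int_multiplier w I R' y"
  unfolding int_multiplier_def
proof (intro conjI allI impI)
  fix B x assume x: "x \<in> int_ball w I B"
  show "y * x \<in> int_ball w I (R' * B)"
  \<comment> \<open>If \<open>I\<close> is nonempty, the existence of \<open>x\<close> forces
    \<open>B\<close> to be nonnegative, as comparing \<open>R * B\<close> with \<open>R' * B\<close>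
    requires. For empty \<open>I\<close> the ball is {0} even for negative \<open>B\<close>.\<close>
  proof (cases "I = {}")
    case True then show ?thesis using x by (auto simp: int_ball_def)
  next
    case False
    then have "B \<ge> 0" using x unfolding int_ball_def by force
    with assms x show ?thesis unfolding int_multiplier_def
      by (meson int_ball_mono mult_right_mono)
  qed
qed (use assms in \<open>auto simp: int_multiplier_def\<close>)

text \<open>Siegel's lemma, applied to the coordinates of the powers of \<open>x\<close>, replaces the characteristic
  polynomial of the multiplication matrix.\<close>

lemma int_multiplier_annihilator:
  fixes x :: "'a::field_char_0" and R :: real
  assumes fin: "finite I" and one: "1 \<in> int_ball w I 1" and mult: "int_multiplier w I R x" and R: "R \<ge> 1"
  shows "\<exists>g. (\<forall>k\<le>2 * card I. \<bar>real_of_int (g k)\<bar> \<le> (2 * card I + 1) * R ^ (2 * card I)) \<and>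
             (\<exists>k\<le>2 * card I. g k \<noteq> 0) \<and> (\<Sum>k\<le>2 * card I. of_int (g k) * x ^ k) = 0"
proof -
  let ?s = "2 * card I"
  have "x ^ k * 1 \<in> int_ball w I (R ^ k * 1)" for k
    using int_multiplier_power[OF mult, of k] one unfolding int_multiplier_def by blast
  then have "\<forall>k. \<exists>c. x ^ k = (\<Sum>i\<in>I. of_int (c i) * w i) \<and> (\<forall>i\<in>I. \<bar>real_of_int (c i)\<bar> \<le> R ^ k)"
    unfolding int_ball_def by auto
  then obtain c where c: "\<And>k. x ^ k = (\<Sum>i\<in>I. of_int (c k i) * w i)"
      "\<And>k i. i \<in> I \<Longrightarrow> \<bar>real_of_int (c k i)\<bar> \<le> R ^ k" by metis
  \<comment> \<open>Siegel's lemma takes a natural number as bound; an integer bounded by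
    \<open>R ^ ?s\<close> is bounded by its floor. The unknowns are the coefficients of the
    \<open>?s + 1\<close> powers, the equations are the \<open>card I\<close> coordinates.\<close>
  define B where "B = nat \<lfloor>R ^ ?s\<rfloor>"
  have B1: "B \<ge> 1" using R by (simp add: B_def le_nat_iff one_le_power)
  have Bs: "real B \<le> R ^ ?s" using R by (simp add: B_def)
  have bd: "\<bar>c k i\<bar> \<le> int B" if "i \<in> I" "k \<in> {..?s}" for i k
  proof -
    have "real_of_int \<bar>c k i\<bar> \<le> R ^ k" using c(2)[OF that(1)] by simp
    also have "\<dots> \<le> R ^ ?s" using that R by (intro power_increasing) auto
    finally have "\<bar>c k i\<bar> \<le> \<lfloor>R ^ ?s\<rfloor>" by (simp add: le_floor_iff)
    then show ?thesis by (simp add: B_def)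
  qed
  obtain g where g: "\<forall>k\<in>{..?s}. \<bar>g k\<bar> \<le> int (card {..?s} * B)" "\<exists>k\<in>{..?s}. g k \<noteq> 0"
      "\<forall>i\<in>I. (\<Sum>k\<in>{..?s}. c k i * g k) = 0"
    using siegel_int[of I "{..?s}" "\<lambda>i k. c k i" B] fin B1 bd by auto
  have "(\<Sum>k\<le>?s. of_int (g k) * x ^ k) = (\<Sum>k\<le>?s. \<Sum>i\<in>I. of_int (c k i * g k) * w i)"
    by (simp add: c sum_distrib_left mult_ac)
  also have "\<dots> = (\<Sum>i\<in>I. of_int (\<Sum>k\<le>?s. c k i * g k) * w i)"
    by (subst sum.swap) (simp add: sum_distrib_right)
  also have "\<dots> = 0" using g(3) by simp
  finally have 1: "(\<Sum>k\<le>?s. of_int (g k) * x ^ k) = 0" .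
  have 2: "\<bar>real_of_int (g k)\<bar> \<le> (?s + 1) * R ^ ?s" if "k \<le> ?s" for k
  proof -
    have "real_of_int \<bar>g k\<bar> \<le> real_of_int (int (card {..?s} * B))"
      using g(1) that by (subst of_int_le_iff) auto
    also have "\<dots> = (?s + 1) * real B" by (simp add: algebra_simps)
    also have "\<dots> \<le> (?s + 1) * R ^ ?s" using Bs by (intro mult_left_mono) auto
    finally show ?thesis by simp
  qed
  show ?thesis using 1 2 g(2) by (intro exI[of _ g]) auto
qed

section \<open>Algebraic numbers form a ring\<close>

lemma algebraic_obtain_int_coeffs:
  fixes x :: "'a::field_char_0"
  assumes "algebraic x"
  obtains p d where "p d \<noteq> 0" "(\<Sum>k\<le>d. of_int (p k) * x ^ k) = (0::'a)"
proof -
  obtain P where P: "\<And>i. coeff P i \<in> \<int>" "P \<noteq> 0" "poly P x = 0"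
    using assms unfolding algebraic_def by blast
  have "\<forall>i. \<exists>z. coeff P i = of_int z" using P(1) by (blast elim: Ints_cases)
  then obtain p where p: "\<And>i. coeff P i = of_int (p i)" by metis
  have "p (degree P) \<noteq> 0" using P(2) p[of "degree P"] by auto
  moreover have "(\<Sum>k\<le>degree P. of_int (p k) * x ^ k) = 0"
    using P(3) p by (simp add: poly_altdef)
  ultimately show ?thesis using that by blast
qed

lemma algebraicI_int_coeffs:
  fixes x :: "'a::field_char_0"
  assumes "(\<Sum>k\<le>d. of_int (p k) * x ^ k) = (0::'a)" "\<exists>k\<le>d. p k \<noteq> 0"
  shows "algebraic x"
proof (rule algebraicI)
  let ?P = "\<Sum>k\<le>d. monom (of_int (p k)) k :: 'a poly"
  have c: "coeff ?P i = (if i \<le> d then of_int (p i) else 0)" for i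
    by (simp add: coeff_sum)
  show "coeff ?P i \<in> \<int>" for i unfolding c by auto
  show "?P \<noteq> 0" using assms(2) c by (metis coeff_0 of_int_eq_0_iff)
  show "poly ?P x = 0" using assms(1) by (simp add: poly_sum poly_monom)
qed

text \<open>The classical passage to an algebraic integer: multiplying the relation by a^(d-1),
  where a is its leading coefficient, makes it monic in a x.\<close>

lemma algebraic_imp_int_multiple_monic:
  fixes x :: "'a::field_char_0"
  assumes "algebraic x"
  obtains a :: int and d e where "a \<noteq> 0" "d \<ge> 1"
    "(of_int a * x) ^ d = (\<Sum>k<d. of_int (e k) * (of_int a * x) ^ k)"
proof -
  obtain p d where p: "p d \<noteq> 0" "(\<Sum>k\<le>d. of_int (p k) * x ^ k) = (0::'a)"
    using assms by (rule algebraic_obtain_int_coeffs)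
  have d: "d \<ge> 1" using p by (cases d) auto
  let ?a = "p d"
  define e where "e k = - (p k * ?a ^ (d - 1 - k))" for k
  have "0 = of_int (?a ^ (d - 1)) * (\<Sum>k\<le>d. of_int (p k) * x ^ k)" using p by simp
  also have "\<dots> = of_int (?a ^ (d - 1)) * (of_int ?a * x ^ d) + of_int (?a ^ (d - 1)) * (\<Sum>k<d. of_int (p k) * x ^ k)"
    by (simp add: distrib_left flip: lessThan_Suc_atMost)
  also have "of_int (?a ^ (d - 1)) * (of_int ?a * x ^ d) = (of_int ?a * x) ^ d"
    using d by (cases d) (auto simp: power_mult_distrib)
  also have "of_int (?a ^ (d - 1)) * (\<Sum>k<d. of_int (p k) * x ^ k) = - (\<Sum>k<d. of_int (e k) * (of_int ?a * x) ^ k)"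
    unfolding sum_distrib_left sum_negf[symmetric]
  proof (intro sum.cong refl)
    fix k assume "k \<in> {..<d}"
    then have "d - 1 = (d - 1 - k) + k" by auto
    then have *: "?a ^ (d - 1) = ?a ^ (d - 1 - k) * ?a ^ k" by (simp flip: power_add)
    show "of_int (?a ^ (d - 1)) * (of_int (p k) * x ^ k) = - (of_int (e k) * (of_int ?a * x) ^ k)"
      unfolding * e_def by (simp add: power_mult_distrib)
  qed
  finally have "(of_int ?a * x) ^ d = (\<Sum>k<d. of_int (e k) * (of_int ?a * x) ^ k)"
    by (simp add: add_eq_0_iff)
  then show ?thesis using p d that by blast
qed

text \<open>With u = a x and v = b y, the monomials u^k v^l for k < d, l < d' span a subgroup that
  contains 1 and is stable under u and v: multiplication raises one exponent, and the monic relation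
  rewrites the top power. One subgroup for both numbers makes sums and products multipliers as
  well.\<close>

lemma algebraic_pair_multipliers:
  fixes x y :: "'a::field_char_0"
  assumes "algebraic x" "algebraic y"
  obtains w :: "nat \<times> nat \<Rightarrow> 'a" and I a b R where "finite I" "1 \<in> int_ball w I 1" "R \<ge> 1"
    "a \<noteq> 0" "b \<noteq> 0" "int_multiplier w I R (of_int a * x)" "int_multiplier w I R (of_int b * y)"
proof -
  obtain a d e where a: "a \<noteq> 0" "d \<ge> 1" 
    "(of_int a * x) ^ d = (\<Sum>k<d. of_int (e k) * (of_int a * x) ^ k)"
    using assms(1) by (rule algebraic_imp_int_multiple_monic)
  obtain b d' e' where b: "b \<noteq> 0" "d' \<ge> 1" 
    "(of_int b * y) ^ d' = (\<Sum>k<d'. of_int (e' k) * (of_int b * y) ^ k)"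
    using assms(2) by (rule algebraic_imp_int_multiple_monic)
  define u v where "u = of_int a * x" and "v = of_int b * y"
  have ud: "u ^ d = (\<Sum>k<d. of_int (e k) * u ^ k)" and vd: "v ^ d' = (\<Sum>k<d'. of_int (e' k) * v ^ k)"
    using a(3) b(3) unfolding u_def v_def by simp_all
  define w where "w = (\<lambda>(k, l). u ^ k * v ^ l)"
  define I where "I = {..<d} \<times> {..<d'}"
  \<comment> \<open>The sums cover the rewriting of a top power by either monic relation; the
    summand 1 covers the products that are again generators.\<close>
  define R where "R = 1 + (\<Sum>k<d. \<bar>real_of_int (e k)\<bar>) + (\<Sum>k<d'. \<bar>real_of_int (e' k)\<bar>)"
  have fin: "finite I" by (simp add: I_def)
  have R1: "R \<ge> 1" unfolding R_def by (simp add: sum_nonneg)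
  have cardI: "card I \<ge> 1" using a b by (simp add: I_def)
  have basis: "u ^ k * v ^ l \<in> int_ball w I 1" if "k < d" "l < d'" for k l
    using int_ball_basis[OF fin, of "(k, l)" w] that by (simp add: I_def w_def)
  have one: "1 \<in> int_ball w I 1" using basis[of 0 0] a b by simp
  have "u * w i \<in> int_ball w I R" if iI: "i \<in> I" for i
  proof -
    obtain k l where i: "i = (k, l)" "k < d" "l < d'" using iI by (auto simp: I_def)
    show ?thesis
    proof (cases "Suc k < d")
      case True
      then have "u * w i \<in> int_ball w I 1" using basis[of "Suc k" l] i by (simp add: w_def mult_ac)
      then show ?thesis using R1 by (rule int_ball_mono)
    next
      case False
      then have "d = Suc k" using i by simp
      then have "u * w i = u ^ d * v ^ l" by (simp add: i w_def mult_ac)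
      also have "\<dots> = (\<Sum>k<d. of_int (e k) * (u ^ k * v ^ l))"
        unfolding ud sum_distrib_right by (simp add: mult.assoc)
      also have "\<dots> \<in> int_ball w I (\<Sum>k<d. \<bar>real_of_int (e k)\<bar> * 1)"
        by (intro int_ball_sum int_ball_scale basis) (use i in auto)
      finally show ?thesis by (rule int_ball_mono) (simp add: R_def sum_nonneg)
    qed
  qed
  then have mu: "int_multiplier w I (card I * R) u" using fin R1 by (intro int_multiplierI) auto
  have "v * w i \<in> int_ball w I R" if iI: "i \<in> I" for i
  proof -
    obtain k l where i: "i = (k, l)" "k < d" "l < d'" using iI by (auto simp: I_def)
    show ?thesis
    proof (cases "Suc l < d'")
      case True
      then have "v * w i \<in> int_ball w I 1" using basis[of k "Suc l"] i by (simp add: w_def mult_ac)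
      then show ?thesis using R1 by (rule int_ball_mono)
    next
      case False
      then have "d' = Suc l" using i by simp
      then have "v * w i = u ^ k * v ^ d'" by (simp add: i w_def mult_ac)
      also have "\<dots> = (\<Sum>l<d'. of_int (e' l) * (u ^ k * v ^ l))"
        unfolding vd sum_distrib_left by (simp add: mult.left_commute)
      also have "\<dots> \<in> int_ball w I (\<Sum>k<d'. \<bar>real_of_int (e' k)\<bar> * 1)"
        by (intro int_ball_sum int_ball_scale basis) (use i in auto)
      finally show ?thesis by (rule int_ball_mono) (simp add: R_def sum_nonneg)
    qed
  qed
  then have mv: "int_multiplier w I (card I * R) v" using fin R1 by (intro int_multiplierI) auto
  have "1 * 1 \<le> real (card I) * R" using cardI R1 by (intro mult_mono) auto
  then show ?thesis using that[OF fin one, of "card I * R" a b] a(1) b(1) mu mv by (simp add: u_def v_def)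
qed

lemma algebraic_int_multiplier:
  assumes "finite I" "1 \<in> int_ball w I 1" "int_multiplier w I R x"
  shows "algebraic x"
proof -
  have "int_multiplier w I (max 1 R) x" using assms(3) by (rule int_multiplier_mono) simp
  from int_multiplier_annihilator[OF assms(1,2) this] show ?thesis
    by (auto intro: algebraicI_int_coeffs)
qed

lemma algebraic_of_int_mult_cancel:
  fixes x :: "'a::field_char_0"
  assumes "algebraic (of_int a * x)" "a \<noteq> 0"
  shows "algebraic x"
proof -
  obtain p d where p: "p d \<noteq> 0" "(\<Sum>k\<le>d. of_int (p k) * (of_int a * x) ^ k) = (0::'a)"
    using assms(1) by (rule algebraic_obtain_int_coeffs)
  have "(\<Sum>k\<le>d. of_int (p k * a ^ k) * x ^ k) = 0"
    using p(2) by (simp add: power_mult_distrib mult_ac)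
  moreover have "\<exists>k\<le>d. p k * a ^ k \<noteq> 0" using p assms(2) by auto
  ultimately show ?thesis by (rule algebraicI_int_coeffs)
qed

lemma algebraic_add:
  fixes x y :: "'a::field_char_0"
  assumes "algebraic x" "algebraic y"
  shows "algebraic (x + y)"
proof -
  obtain w :: "nat \<times> nat \<Rightarrow> 'a" and I a b R where w: "finite I" "1 \<in> int_ball w I 1" "R \<ge> 1"
    "a \<noteq> 0" "b \<noteq> 0" "int_multiplier w I R (of_int a * x)" "int_multiplier w I R (of_int b * y)"
    using assms by (rule algebraic_pair_multipliers)
  have "int_multiplier w I (\<bar>real_of_int b\<bar> * R + \<bar>real_of_int a\<bar> * R)
          (of_int b * (of_int a * x) + of_int a * (of_int b * y))"
    by (intro int_multiplier_add int_multiplier_mult int_multiplier_of_int w)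
  then have "algebraic (of_int b * (of_int a * x) + of_int a * (of_int b * y))"
    using w by (intro algebraic_int_multiplier)
  also have "of_int b * (of_int a * x) + of_int a * (of_int b * y) = of_int (a * b) * (x + y)"
    by (simp add: algebra_simps)
  finally show ?thesis using w by (elim algebraic_of_int_mult_cancel) simp
qed

lemma algebraic_mult:
  fixes x y :: "'a::field_char_0"
  assumes "algebraic x" "algebraic y"
  shows "algebraic (x * y)"
proof -
  obtain w :: "nat \<times> nat \<Rightarrow> 'a" and I a b R where w: "finite I" "1 \<in> int_ball w I 1" "R \<ge> 1"
    "a \<noteq> 0" "b \<noteq> 0" "int_multiplier w I R (of_int a * x)" "int_multiplier w I R (of_int b * y)"
    using assms by (rule algebraic_pair_multipliers)
  have "int_multiplier w I (R * R) ((of_int a * x) * (of_int b * y))"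
    by (intro int_multiplier_mult w)
  then have "algebraic ((of_int a * x) * (of_int b * y))"
    using w by (intro algebraic_int_multiplier)
  also have "(of_int a * x) * (of_int b * y) = of_int (a * b) * (x * y)"
    by (simp add: algebra_simps)
  finally show ?thesis using w by (elim algebraic_of_int_mult_cancel) simp
qed

text \<open>Cauchy's root bound at the low end of the integer relation. Dividing by the lowest power
  of x that occurs leaves a nonzero integer, which is minus a sum of terms divisible by x. For |x| <
  1 there are at most s + 1 of them, each at most (s + 1) R^s |x| with s = 2 *
  \<open>card I\<close>; hence the square.\<close>

lemma int_multiplier_lower_bound:
  fixes x R :: real
  assumes fin: "finite I" and one: "1 \<in> int_ball w I 1" and mult: "int_multiplier w I R x" and R: "R \<ge> 1"
    and x0: "x \<noteq> 0"
  shows "1 \<le> \<bar>x\<bar> * ((2 * card I + 1) ^ 2 * R ^ (2 * card I))"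
proof (cases "\<bar>x\<bar> \<ge> 1")
  case True
  have "(1::real) * 1 \<le> (2 * card I + 1) ^ 2 * R ^ (2 * card I)"
    using R by (intro mult_mono one_le_power) auto
  then have "1 * 1 \<le> \<bar>x\<bar> * ((2 * card I + 1) ^ 2 * R ^ (2 * card I))"
    using True by (intro mult_mono) auto
  then show ?thesis by simp
next
  case False
  let ?s = "2 * card I"
  obtain g where g: "\<forall>k\<le>?s. \<bar>real_of_int (g k)\<bar> \<le> (?s + 1) * R ^ ?s"
      "\<exists>k\<le>?s. g k \<noteq> 0" "(\<Sum>k\<le>?s. of_int (g k) * x ^ k) = 0"
    using int_multiplier_annihilator[OF fin one mult R] by auto
  define m where "m = (LEAST k. k \<le> ?s \<and> g k \<noteq> 0)"
  have m: "m \<le> ?s" "g m \<noteq> 0" and least: "\<And>k. k < m \<Longrightarrow> g k = 0"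
  proof -
    show "m \<le> ?s" "g m \<noteq> 0" using LeastI_ex[OF g(2)] unfolding m_def by auto
    show "g k = 0" if "k < m" for k
      using not_less_Least[OF that[unfolded m_def]] that \<open>m \<le> ?s\<close> by auto
  qed
  have "0 = (\<Sum>k\<in>{m..?s}. of_int (g k) * x ^ k)"
    unfolding g(3)[symmetric] using least by (intro sum.mono_neutral_right) (auto simp: not_le)
  also have "\<dots> = x ^ m * (\<Sum>k\<in>{m..?s}. of_int (g k) * x ^ (k - m))"
    unfolding sum_distrib_left
  proof (intro sum.cong refl)
    fix k assume "k \<in> {m..?s}"
    then have "x ^ k = x ^ m * x ^ (k - m)" by (simp flip: power_add)
    then show "of_int (g k) * x ^ k = x ^ m * (of_int (g k) * x ^ (k - m))" by simp
  qed
  finally have "(\<Sum>k\<in>{m..?s}. of_int (g k) * x ^ (k - m)) = 0" using x0 by simp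
  then have eq: "of_int (g m) = - (\<Sum>k\<in>{Suc m..?s}. of_int (g k) * x ^ (k - m))"
    using m by (simp add: sum.atLeast_Suc_atMost add_eq_0_iff)
  have "1 \<le> \<bar>real_of_int (g m)\<bar>" using m(2) by linarith
  also have "\<dots> \<le> (\<Sum>k\<in>{Suc m..?s}. \<bar>of_int (g k) * x ^ (k - m)\<bar>)"
    unfolding eq by (simp add: sum_abs)
  also have "\<dots> \<le> (\<Sum>k\<in>{Suc m..?s}. (?s + 1) * R ^ ?s * \<bar>x\<bar>)"
  proof (intro sum_mono)
    fix k assume k: "k \<in> {Suc m..?s}"
    have "\<bar>x\<bar> ^ (k - m) \<le> \<bar>x\<bar> ^ 1" using k False by (intro power_decreasing) auto
    then show "\<bar>of_int (g k) * x ^ (k - m)\<bar> \<le> (?s + 1) * R ^ ?s * \<bar>x\<bar>"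
      unfolding abs_mult power_abs using g(1) k R by (intro mult_mono) auto
  qed
  also have "\<dots> = card {Suc m..?s} * ((?s + 1) * R ^ ?s * \<bar>x\<bar>)" by simp
  also have "\<dots> \<le> (?s + 1) * ((?s + 1) * R ^ ?s * \<bar>x\<bar>)"
    using R by (intro mult_right_mono) auto
  finally show ?thesis by (simp add: power2_eq_square algebra_simps)
qed

text \<open>Scaled by a^n b^q, the value becomes a multiplier of norm at most K A^(n+q), to which
  the lower bound applies. What matters is uniformity: \<open>C\<close> and \<open>D\<close> depend
  only on the two numbers, not on \<open>n\<close>, \<open>q\<close>, \<open>K\<close>.\<close>

lemma liouville_pair:
  fixes \<alpha> \<beta> :: real
  assumes "algebraic \<alpha>" "algebraic \<beta>"
  obtains C :: real and D :: nat where "C \<ge> 1"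
    "\<And>n q K (c :: nat \<Rightarrow> nat \<Rightarrow> int). K \<ge> 1 \<Longrightarrow> (\<Sum>i<n. \<Sum>j<q. \<bar>real_of_int (c i j)\<bar>) \<le> K \<Longrightarrow>
       (\<Sum>i<n. \<Sum>j<q. of_int (c i j) * \<alpha> ^ i * \<beta> ^ j) \<noteq> 0 \<Longrightarrow>
       1 \<le> \<bar>\<Sum>i<n. \<Sum>j<q. of_int (c i j) * \<alpha> ^ i * \<beta> ^ j\<bar> * (C ^ (n + q) * K) ^ D"
proof -
  obtain w :: "nat \<times> nat \<Rightarrow> real" and I a b R where w: "finite I" "1 \<in> int_ball w I 1" "R \<ge> 1"
    "a \<noteq> 0" "b \<noteq> 0" "int_multiplier w I R (of_int a * \<alpha>)" "int_multiplier w I R (of_int b * \<beta>)"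
    using assms by (rule algebraic_pair_multipliers)
  define A where "A = \<bar>real_of_int a\<bar> * \<bar>real_of_int b\<bar> * R"
  define s where "s = 2 * card I"
  have ab: "1 \<le> \<bar>real_of_int a\<bar>" "1 \<le> \<bar>real_of_int b\<bar>" using w(4,5) by linarith+
  have "1 * 1 \<le> \<bar>real_of_int a\<bar> * \<bar>real_of_int b\<bar>" using ab by (intro mult_mono) auto
  then have ab1: "1 \<le> \<bar>real_of_int a\<bar> * \<bar>real_of_int b\<bar>" by simp
  then have "1 * 1 \<le> A" unfolding A_def using w(3) by (intro mult_mono) auto
  then have A1: "1 \<le> A" by simp
  define C where "C = (s + 1) ^ 2 * A"
  have AC: "A \<le> C" and C1: "1 \<le> C" and sC: "(s + 1) ^ 2 \<le> C"
  proof -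
    have "1 * A \<le> (s + 1) ^ 2 * A" using A1 by (intro mult_right_mono) auto
    then show "A \<le> C" by (simp add: C_def)
    then show "1 \<le> C" using A1 by simp
    have "real ((s + 1) ^ 2) * 1 \<le> (s + 1) ^ 2 * A" using A1 by (intro mult_left_mono) auto
    then show "(s + 1) ^ 2 \<le> C" by (simp add: C_def)
  qed
  \<comment> \<open>Of the s + 2 factors, s bound the power of the norm, one absorbs (s + 1)^2, and
    one the denominator a^n b^q.\<close>
  have "1 \<le> \<bar>y\<bar> * (C ^ (n + q) * K) ^ (s + 2)"
    if K: "K \<ge> 1" "(\<Sum>i<n. \<Sum>j<q. \<bar>real_of_int (c i j)\<bar>) \<le> K" and y0: "y \<noteq> 0"
     and y: "y = (\<Sum>i<n. \<Sum>j<q. of_int (c i j) * \<alpha> ^ i * \<beta> ^ j)"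
    for n q K y and c :: "nat \<Rightarrow> nat \<Rightarrow> int"
  proof -
    define x where "x = of_int (a ^ n * b ^ q) * y"
    \<comment> \<open>A nonzero sum is nonempty; this makes C <= C^(n+q), where (s + 1)^2 is
      absorbed.\<close>
    have nq: "n + q \<ge> 1" using y0 y by (cases n) auto
    have Apow: "1 \<le> A ^ (n + q)" using A1 by (rule one_le_power)
    have "x = (\<Sum>i<n. \<Sum>j<q. of_int (c i j * a ^ (n - i) * b ^ (q - j)) * ((of_int a * \<alpha>) ^ i * (of_int b * \<beta>) ^ j))"
      unfolding x_def y sum_distrib_left
    proof (intro sum.cong refl)
      fix i j assume "i \<in> {..<n}" "j \<in> {..<q}"
      then have "a ^ n = a ^ (n - i) * a ^ i" "b ^ q = b ^ (q - j) * b ^ j"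
        by (simp_all flip: power_add)
      then show "of_int (a ^ n * b ^ q) * (of_int (c i j) * \<alpha> ^ i * \<beta> ^ j) =
        of_int (c i j * a ^ (n - i) * b ^ (q - j)) * ((of_int a * \<alpha>) ^ i * (of_int b * \<beta>) ^ j)"
        by (simp add: power_mult_distrib mult_ac)
    qed
    moreover have "int_multiplier w I (\<Sum>i<n. \<Sum>j<q. \<bar>real_of_int (c i j * a ^ (n - i) * b ^ (q - j))\<bar> * (R ^ i * R ^ j)) \<dots>"
      by (intro int_multiplier_sum int_multiplier_mult int_multiplier_of_int int_multiplier_power w) auto
    ultimately have mx: "int_multiplier w I (\<Sum>i<n. \<Sum>j<q. \<bar>real_of_int (c i j * a ^ (n - i) * b ^ (q - j))\<bar> * (R ^ i * R ^ j)) x"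
      by simp
    have "(\<Sum>i<n. \<Sum>j<q. \<bar>real_of_int (c i j * a ^ (n - i) * b ^ (q - j))\<bar> * (R ^ i * R ^ j))
       \<le> (\<Sum>i<n. \<Sum>j<q. \<bar>real_of_int (c i j)\<bar> * A ^ (n + q))"
    proof (intro sum_mono)
      fix i j assume ij: "i \<in> {..<n}" "j \<in> {..<q}"
      have "\<bar>real_of_int a\<bar> ^ (n - i) * \<bar>real_of_int b\<bar> ^ (q - j) * (R ^ i * R ^ j)
         \<le> \<bar>real_of_int a\<bar> ^ (n + q) * \<bar>real_of_int b\<bar> ^ (n + q) * R ^ (n + q)"
        unfolding power_add[symmetric, of R]
        using ab w(3) ij by (intro mult_mono power_increasing) auto
      also have "\<dots> = A ^ (n + q)" by (simp add: A_def power_mult_distrib)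
      finally have "\<bar>real_of_int (c i j)\<bar> * (\<bar>real_of_int a\<bar> ^ (n - i) * \<bar>real_of_int b\<bar> ^ (q - j) * (R ^ i * R ^ j))
        \<le> \<bar>real_of_int (c i j)\<bar> * A ^ (n + q)" by (rule mult_left_mono) simp
      then show "\<bar>real_of_int (c i j * a ^ (n - i) * b ^ (q - j))\<bar> * (R ^ i * R ^ j) \<le> \<bar>real_of_int (c i j)\<bar> * A ^ (n + q)"
        by (simp add: abs_mult power_abs mult_ac)
    qed
    also have "\<dots> = (\<Sum>i<n. \<Sum>j<q. \<bar>real_of_int (c i j)\<bar>) * A ^ (n + q)" by (simp add: sum_distrib_right)
    also have "\<dots> \<le> K * A ^ (n + q)" using K Apow by (intro mult_right_mono) auto
    finally have mx: "int_multiplier w I (K * A ^ (n + q)) x" by (rule int_multiplier_mono[OF mx])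
    have "1 * 1 \<le> K * A ^ (n + q)" using K Apow by (intro mult_mono) auto
    moreover have x0: "x \<noteq> 0" using y0 w by (simp add: x_def)
    ultimately have "1 \<le> \<bar>x\<bar> * ((s + 1) ^ 2 * (K * A ^ (n + q)) ^ s)"
      using int_multiplier_lower_bound[OF w(1,2) mx] by (simp add: s_def)
    also have "\<dots> \<le> (\<bar>y\<bar> * (C ^ (n + q) * K)) * ((C ^ (n + q) * K) * (C ^ (n + q) * K) ^ s)"
    proof -
      have "C ^ 1 \<le> C ^ (n + q)" using nq C1 by (intro power_increasing) auto
      moreover have 2: "C ^ (n + q) * 1 \<le> C ^ (n + q) * K" using K C1 by (intro mult_left_mono) auto
      ultimately have 4: "(s + 1) ^ 2 \<le> C ^ (n + q) * K" using sC by simp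
      have 3: "A ^ (n + q) \<le> C ^ (n + q)" using AC A1 by (intro power_mono) auto
      have 5: "K * A ^ (n + q) \<le> C ^ (n + q) * K" using mult_right_mono[OF 3, of K] K by (simp add: mult.commute)
      have "\<bar>real_of_int a\<bar> ^ n * \<bar>real_of_int b\<bar> ^ q \<le> \<bar>real_of_int a\<bar> ^ (n + q) * \<bar>real_of_int b\<bar> ^ (n + q)"
        using ab by (intro mult_mono power_increasing) auto
      also have "\<dots> \<le> \<bar>real_of_int a\<bar> ^ (n + q) * \<bar>real_of_int b\<bar> ^ (n + q) * R ^ (n + q)"
        using mult_left_mono[OF one_le_power[OF w(3), of "n + q"], of "\<bar>real_of_int a\<bar> ^ (n + q) * \<bar>real_of_int b\<bar> ^ (n + q)"] by simp
      also have "\<dots> = A ^ (n + q)" by (simp add: A_def power_mult_distrib)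
      finally have "\<bar>real_of_int a\<bar> ^ n * \<bar>real_of_int b\<bar> ^ q \<le> C ^ (n + q) * K" using 2 3 by simp
      from mult_left_mono[OF this, of "\<bar>y\<bar>"] have 6: "\<bar>x\<bar> \<le> \<bar>y\<bar> * (C ^ (n + q) * K)"
        unfolding x_def by (simp add: abs_mult power_abs mult.commute)
      have 7: "(K * A ^ (n + q)) ^ s \<le> (C ^ (n + q) * K) ^ s" using 5 K A1 by (intro power_mono) auto
      have 8: "(s + 1) ^ 2 * (K * A ^ (n + q)) ^ s \<le> (C ^ (n + q) * K) * (C ^ (n + q) * K) ^ s"
        by (rule mult_mono[OF 4 7]) (use K A1 C1 in auto)
      show ?thesis by (rule mult_mono[OF 6 8]) (use K A1 C1 in auto)
    qed
    also have "\<dots> = \<bar>y\<bar> * (C ^ (n + q) * K) ^ (s + 2)" by simp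
    finally show ?thesis .
  qed
  then show ?thesis using that[OF C1, of "s + 2"] by blast
qed

subsection \<open>Zeros and values of real functions\<close>

text \<open>Induction with a moving right end: without its maximum m, the set lies in [a, b'] with
  b' the next largest zero, and Rolle's theorem on [b', m] supplies a zero beyond those already
  found.\<close>

lemma rolle_finite:
  fixes f f' :: "real \<Rightarrow> real"
  assumes deriv: "\<And>x. (f has_real_derivative f' x) (at x)"
  shows "finite X \<Longrightarrow> card X = Suc k \<Longrightarrow> X \<subseteq> {a..b} \<Longrightarrow> (\<And>x. x \<in> X \<Longrightarrow> f x = 0) \<Longrightarrow>
    \<exists>Y. finite Y \<and> Y \<subseteq> {a<..<b} \<and> card Y = k \<and> (\<forall>y\<in>Y. f' y = 0)"
proof (induction k arbitrary: X b)
  case 0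
  then show ?case by (intro exI[of _ "{}"]) auto
next
  case (Suc k)
  define m where "m = Max X"
  define X' where "X' = X - {m}"
  define b' where "b' = Max X'"
  have mX: "m \<in> X" unfolding m_def using Suc.prems by (intro Max_in) auto
  have X': "finite X'" "card X' = Suc k" using Suc.prems mX by (auto simp: X'_def)
  then have b'X: "b' \<in> X'" unfolding b'_def by (intro Max_in) auto
  have le_m: "x \<le> m" if "x \<in> X" for x using that Suc.prems by (simp add: m_def)
  have b'm: "b' < m" using b'X le_m[of b'] by (auto simp: X'_def)
  have "a \<le> x \<and> x \<le> b'" if "x \<in> X'" for x
    using Max_ge[OF X'(1) that] that Suc.prems(3) by (auto simp: b'_def X'_def)
  then have "X' \<subseteq> {a..b'}" by auto
  then obtain Y where Y: "finite Y" "Y \<subseteq> {a<..<b'}" "card Y = k" "\<forall>y\<in>Y. f' y = 0"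
    using Suc.IH[OF X'] Suc.prems(4) by (auto simp: X'_def)
  have "continuous_on {b'..m} f"
    using deriv by (meson DERIV_continuous continuous_at_imp_continuous_on)
  moreover have "f b' = f m" using b'X mX Suc.prems(4) by (simp add: X'_def)
  ultimately obtain z where z: "b' < z" "z < m" "(\<lambda>h. f' z * h) = (\<lambda>h. 0)"
    using Rolle_deriv[OF b'm, of f "\<lambda>x h. f' x * h"] deriv unfolding has_field_derivative_def by blast
  have "f' z = 0" using fun_cong[OF z(3), of 1] by simp
  have "b' \<in> {a..b}" "m \<in> {a..b}" using b'X mX Suc.prems(3) by (auto simp: X'_def)
  then show ?case using Y z \<open>f' z = 0\<close> by (intro exI[of _ "insert z Y"]) (auto simp: card_insert_if)
qed

text \<open>The truncated difference counts the zeros: every step of Rolle's theorem loses one zero, but gains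
  one at each of the end points where the current derivative still vanishes.\<close>

lemma rolle_two_points:
  fixes F :: "nat \<Rightarrow> real \<Rightarrow> real"
  assumes deriv: "\<And>k x. (F k has_real_derivative F (Suc k) x) (at x)"
    and ab: "a < b" and a: "\<And>k. k < m \<Longrightarrow> F k a = 0" and b: "\<And>k. k < s \<Longrightarrow> F k b = 0"
  shows "\<exists>X. finite X \<and> X \<subseteq> {a<..<b} \<and> min k m + min k s - k \<le> card X \<and> (\<forall>x\<in>X. F k x = 0)"
proof (induction k)
  case 0
  then show ?case by (intro exI[of _ "{}"]) auto
next
  case (Suc k)
  then obtain X where X: "finite X" "X \<subseteq> {a<..<b}" "min k m + min k s - k \<le> card X" "\<forall>x\<in>X. F k x = 0"
    by blast
  define Z where "Z = X \<union> (if k < m then {a} else {}) \<union> (if k < s then {b} else {})"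
  have cZ: "card Z = card X + (if k < m then 1 else 0) + (if k < s then 1 else 0)"
  proof -
    have "a \<notin> X" "b \<notin> X" using X(2) by auto
    then show ?thesis using X(1) ab by (auto simp: Z_def)
  qed
  show ?case
  proof (cases "card Z")
    case 0
    then show ?thesis using cZ X(3) by (intro exI[of _ "{}"]) (auto split: if_splits)
  next
    case (Suc j)
    have "finite Z" "Z \<subseteq> {a..b}" "\<And>x. x \<in> Z \<Longrightarrow> F k x = 0"
      using X ab a[of k] b[of k] by (force simp: Z_def split: if_splits)+
    from rolle_finite[OF deriv this(1) Suc this(2,3)] obtain Y where
      "finite Y" "Y \<subseteq> {a<..<b}" "card Y = j" "\<forall>y\<in>Y. F (Suc k) y = 0" by blast
    moreover have "min (Suc k) m + min (Suc k) s - Suc k \<le> j"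
      using cZ Suc X(3) by (auto split: if_splits)
    ultimately show ?thesis by blast
  qed
qed

text \<open>The cofactor \<open>R\<close> is arbitrary in the induction: differentiating (x -
  a)^(m+1) R leaves (x - a)^m times (m + 1) R + (x - a) R', whose value at a is (m + 1) R(a). These
  factors build up the factorial.\<close>

lemma higher_pderiv_linear_power:
  fixes a :: real
  assumes "k \<le> m"
  shows "poly ((pderiv ^^ k) ([:-a, 1:] ^ m * R)) a = (if k = m then fact m * poly R a else 0)"
  using assms
proof (induction m arbitrary: k R)
  case (Suc m)
  show ?case
  proof (cases k)
    case (Suc k')
    have "pderiv ([:-a, 1:] ^ Suc m * R) = [:-a, 1:] ^ m * (smult (of_nat (Suc m)) R + [:-a, 1:] * pderiv R)"
  
      unfolding pderiv_mult pderiv_power_Suc by (simp add: pderiv_pCons algebra_simps smult_add_right)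
    then have "poly ((pderiv ^^ k) ([:-a, 1:] ^ Suc m * R)) a =
        poly ((pderiv ^^ k') ([:-a, 1:] ^ m * (smult (of_nat (Suc m)) R + [:-a, 1:] * pderiv R))) a"
      by (simp add: Suc funpow_Suc_right del: funpow.simps power_Suc)
    also have "\<dots> = (if k' = m then fact m * poly (smult (of_nat (Suc m)) R + [:-a, 1:] * pderiv R) a else 0)"
      using Suc.prems Suc by (intro Suc.IH) auto
    finally show ?thesis using Suc by (simp add: algebra_simps)
  qed auto
qed auto

text \<open>A multiple of $(x - a)^m (x - b)^t$ is subtracted from \<open>F\<close> so that it vanishes at \<open>b\<close> to one order more.\<close>

lemma value_at_second_zero:
  fixes F :: "nat \<Rightarrow> real \<Rightarrow> real"
  assumes deriv: "\<And>k x. (F k has_real_derivative F (Suc k) x) (at x)"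
    and ab: "a \<noteq> b" and a: "\<And>k. k < m \<Longrightarrow> F k a = 0" and b: "\<And>k. k < t \<Longrightarrow> F k b = 0"
  shows "\<exists>\<xi>\<in>{min a b..max a b}. F t b = fact t * (b - a) ^ m * F (m + t) \<xi> / fact (m + t)"
\<comment> \<open>With no zeros at \<open>a\<close>, counting by Rolle's theorem yields no zero of
  the last derivative; but then the claim is an identity at \<open>b\<close> itself.\<close>
proof (cases "m = 0")
  case True
  then show ?thesis by (intro bexI[of _ b]) auto
next
  case False
  define Q where "Q = [:-a, 1:] ^ m * [:-b, 1:] ^ t"
  \<comment> \<open>Chosen so that the t-th derivative of G vanishes at b, because that of Q is t!
    (b - a)^m there. Then G has m + t + 1 zeros with multiplicity, and one survives m + t
    differentiations. As Q is monic of degree m + t, its last derivative is the constant (m +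
    t)!.\<close>
  define c where "c = F t b / (fact t * (b - a) ^ m)"
  define G where "G k x = F k x - c * poly ((pderiv ^^ k) Q) x" for k x
  have Qa: "poly ((pderiv ^^ k) Q) a = 0" if "k < m" for k
    using higher_pderiv_linear_power[of k m a "[:-b, 1:] ^ t"] that by (simp add: Q_def)
  have Qb: "poly ((pderiv ^^ k) Q) b = (if k = t then fact t * (b - a) ^ m else 0)" if "k \<le> t" for k
    using higher_pderiv_linear_power[of k t b "[:-a, 1:] ^ m"] that by (simp add: Q_def mult.commute)
  have "degree Q = m + t" by (simp add: Q_def degree_mult_eq degree_power_eq)
  moreover have "lead_coeff Q = 1" unfolding Q_def lead_coeff_mult lead_coeff_power by simp
  ultimately have "coeff ((pderiv ^^ (m + t)) Q) k = (if k = 0 then fact (m + t) else 0)" for k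
    by (auto simp: coeff_higher_pderiv pochhammer_fact coeff_eq_0)
  then have "(pderiv ^^ (m + t)) Q = [:fact (m + t):]"
    by (intro poly_eqI) (simp add: coeff_pCons split: nat.split)
  then have Qtop: "poly ((pderiv ^^ (m + t)) Q) x = fact (m + t)" for x by simp
  have derivG: "(G k has_real_derivative G (Suc k) x) (at x)" for k x
    unfolding G_def by (auto intro!: derivative_eq_intros deriv poly_DERIV)
  have Ga: "G k a = 0" if "k < m" for k using that a Qa by (simp add: G_def)
  have Gb: "G k b = 0" if "k < Suc t" for k
    using that b[of k] Qb[of k] ab by (cases "k = t") (auto simp: G_def c_def)
  have "\<exists>\<xi>\<in>{min a b..max a b}. G (m + t) \<xi> = 0"
  proof (cases "a < b")
    case True
    obtain X where "finite X" "X \<subseteq> {a<..<b}" "min (m + t) m + min (m + t) (Suc t) - (m + t) \<le> card X" "\<forall>x\<in>X. G (m + t) x = 0"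
      using rolle_two_points[where F = G and k = "m + t" and m = m and s = "Suc t", OF derivG True Ga Gb] by blast
    then have "X \<noteq> {}" using \<open>m \<noteq> 0\<close> by auto
    then obtain x where "x \<in> X" by blast
    then have "a < x" "x < b" "G (m + t) x = 0" using \<open>X \<subseteq> _\<close> \<open>\<forall>x\<in>X. _\<close> by auto
    then show ?thesis by (intro bexI[of _ x]) auto
  next
    case False
    then have "b < a" using ab by simp
    obtain X where "finite X" "X \<subseteq> {b<..<a}" "min (m + t) (Suc t) + min (m + t) m - (m + t) \<le> card X" "\<forall>x\<in>X. G (m + t) x = 0"
      using rolle_two_points[where F = G and k = "m + t" and m = "Suc t" and s = m, OF derivG \<open>b < a\<close> Gb Ga] by blast
    then have "X \<noteq> {}" using \<open>m \<noteq> 0\<close> by auto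
    then obtain x where "x \<in> X" by blast
    then have "b < x" "x < a" "G (m + t) x = 0" using \<open>X \<subseteq> _\<close> \<open>\<forall>x\<in>X. _\<close> by auto
    then show ?thesis by (intro bexI[of _ x]) auto
  qed
  then obtain \<xi> where \<xi>: "\<xi> \<in> {min a b..max a b}" "G (m + t) \<xi> = 0" by blast
  then have "F (m + t) \<xi> = c * fact (m + t)" using Qtop by (simp add: G_def)
  then have "F t b = fact t * (b - a) ^ m * F (m + t) \<xi> / fact (m + t)" using ab by (simp add: c_def)
  then show ?thesis using \<xi> by blast
qed

text \<open>Dividing by the fastest exponential expresses its coefficient polynomial through terms
  that decay at infinity. A polynomial tending to 0 is 0, and induction removes one exponential at a
  time.\<close>

lemma exp_poly_independent:
  fixes P :: "nat \<Rightarrow> real poly"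
  assumes "\<And>x. (\<Sum>j<q. poly (P j) x * exp (real j * x)) = 0" "j < q"
  shows "P j = 0"
  using assms
proof (induction q arbitrary: j)
  case (Suc q)
  have eq: "poly (P q) x = - (\<Sum>j<q. poly (P j) x * exp (- (real (q - j) * x)))" for x
  proof -
    have "0 = exp (- (real q * x)) * (\<Sum>j<Suc q. poly (P j) x * exp (real j * x))" using Suc.prems by simp
    also have "\<dots> = (\<Sum>j<Suc q. poly (P j) x * exp (real j * x - real q * x))"
      unfolding sum_distrib_left by (intro sum.cong) (auto simp: exp_diff exp_minus field_simps)
    also have "\<dots> = poly (P q) x + (\<Sum>j<q. poly (P j) x * exp (real j * x - real q * x))" by simp
    also have "(\<Sum>j<q. poly (P j) x * exp (real j * x - real q * x)) = (\<Sum>j<q. poly (P j) x * exp (- (real (q - j) * x)))"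
      by (intro sum.cong) (auto simp: of_nat_diff algebra_simps)
    finally show ?thesis by simp
  qed
  have "((\<lambda>x. - (\<Sum>j<q. poly (P j) x * exp (- (real (q - j) * x)))) \<longlongrightarrow> - (\<Sum>j<q. 0)) at_top"
  proof (intro tendsto_minus tendsto_sum)
    fix j assume "j \<in> {..<q}"
    then have r: "real (q - j) > 0" by simp
    have mono: "((\<lambda>x. x ^ k * exp (- (real (q - j) * x))) \<longlongrightarrow> 0) at_top" for k
      using r by real_asymp
    have "((\<lambda>x. \<Sum>k\<le>degree (P j). coeff (P j) k * (x ^ k * exp (- (real (q - j) * x)))) \<longlongrightarrow> (\<Sum>k\<le>degree (P j). coeff (P j) k * 0)) at_top"
      by (intro tendsto_intros mono)
    then show "((\<lambda>x. poly (P j) x * exp (- (real (q - j) * x))) \<longlongrightarrow> 0) at_top"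
      by (simp add: poly_altdef sum_distrib_right mult.assoc)
  qed
  then have lim: "(poly (P q) \<longlongrightarrow> 0) at_top" unfolding eq[symmetric] by simp
  have "P q = 0"
  proof (cases "degree (P q) = 0")
    case True
    then obtain c where c: "P q = [:c:]" by (metis degree_eq_zeroE)
    then have "poly (P q) = (\<lambda>_. c)" by (simp add: fun_eq_iff)
    then have "((\<lambda>_. c) \<longlongrightarrow> 0) (at_top :: real filter)" using lim by simp
    then show ?thesis using c by (simp add: tendsto_const_iff)
  next
    case False
    then have "filterlim (poly (P q)) at_infinity at_top"
      by (intro filterlim_compose[OF filterlim_poly_at_infinity filterlim_at_top_imp_at_infinity]) (auto intro: filterlim_ident)
    with lim show ?thesis using not_tendsto_and_filterlim_at_infinity[of at_top "poly (P q)" 0] by simp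
  qed
  show ?case
  proof (cases "j = q")
    case False
    then show ?thesis using Suc.IH[of j] Suc.prems \<open>P q = 0\<close> by simp
  qed (use \<open>P q = 0\<close> in simp)
qed auto

section \<open>Factorials against exponentials\<close>

lemma fact_mult_le_fact_add: "fact m * fact n \<le> (fact (m + n) :: real)"
proof -
  have "(fact m * fact n :: nat) \<le> fact (m + n)"
    by (intro dvd_imp_le fact_fact_dvd_fact) auto
  then have "real (fact m * fact n) \<le> real (fact (m + n))" by (rule of_nat_mono)
  then show ?thesis by simp
qed

text \<open>Split m = r + n e with r >= n. Then m <= (e + 1) r, so C^m is at most (C^(e+1))^r, which
  is below r! once n is large; and r! n!^e <= m!. The single \<open>n\<close> serves all larger
  \<open>m\<close>, since the order of vanishing is known only from below.\<close>

lemma factorial_growth: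
  fixes C :: real
  assumes "C \<ge> 1"
  obtains n :: nat where "n \<ge> 1" "\<And>m. m \<ge> n * (e + 1) \<Longrightarrow> C ^ m * fact n ^ e < fact m"
proof -
  have "(\<lambda>m. (C ^ (e + 1)) ^ m / fact m) \<longlonglongrightarrow> 0"
    using summable_exp[of "C ^ (e + 1)"] by (intro summable_LIMSEQ_zero) (simp add: field_simps)
  then have "eventually (\<lambda>m. (C ^ (e + 1)) ^ m / fact m < 1) sequentially"
    by (rule order_tendstoD) simp
  then obtain n0 where n0: "\<And>m. m \<ge> n0 \<Longrightarrow> (C ^ (e + 1)) ^ m < fact m"
    unfolding eventually_sequentially by (auto simp: field_simps)
  define n where "n = max 1 n0"
  have "C ^ m * fact n ^ e < fact m" if m: "m \<ge> n * (e + 1)" for m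
  proof -
    define r where "r = m - n * e"
    have r: "m = r + n * e" "r \<ge> n" using m by (auto simp: r_def algebra_simps)
    have "m \<le> (e + 1) * r" using r mult_le_mono1[of n r e] by (simp add: algebra_simps)
    then have "C ^ m \<le> (C ^ (e + 1)) ^ r"
      unfolding power_mult[symmetric] using assms by (intro power_increasing)
    also have "\<dots> < fact r" using r by (intro n0) (simp add: n_def)
    finally have "C ^ m * fact n ^ e < fact r * fact n ^ e" by simp
    also have "\<dots> \<le> fact m"
    proof -
      have "(fact r * fact n ^ k :: real) \<le> fact (r + n * k)" for k
      proof (induction k)
        case (Suc k)
        have "fact r * fact n ^ Suc k \<le> (fact (r + n * k) * fact n :: real)"
          using mult_right_mono[OF Suc, of "fact n"] by (simp add: mult_ac)
        also have "\<dots> \<le> fact (r + n * k + n)" by (rule fact_mult_le_fact_add)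
        finally show ?case by (simp add: algebra_simps)
      qed simp
      then show ?thesis using r by simp
    qed
    finally show ?thesis .
  qed
  then show ?thesis using that[of n] by (simp add: n_def)
qed

subsection \<open>The Hermite--Lindemann theorem for real exponents\<close>

text \<open>The coefficients of $A' + j A$, from $(A(x) e^{jx})' = (A'(x) + j A(x)) e^{jx}$.\<close>

definition exp_deriv_coeffs :: "nat \<Rightarrow> (nat \<Rightarrow> int) \<Rightarrow> nat \<Rightarrow> int" where
  "exp_deriv_coeffs j c i = int (Suc i) * c (Suc i) + int j * c i"

text \<open>The argument \<open>k\<close> is the order of differentiation, carried out on
  coefficients. All derivatives thus visibly have integer coefficients, and the family in
  \<open>k\<close> is in the form that the lemmas from Rolle's theorem take.\<close>

definition exp_poly :: "nat \<Rightarrow> nat \<Rightarrow> (nat \<Rightarrow> nat \<Rightarrow> int) \<Rightarrow> nat \<Rightarrow> real \<Rightarrow> real" where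
  "exp_poly n q c k x = (\<Sum>j<q. (\<Sum>i<n. of_int ((exp_deriv_coeffs j ^^ k) (c j) i) * x ^ i) * exp (real j * x))"

lemma exp_deriv_coeffs_funpow_eq_0:
  assumes "\<And>i. i \<ge> n \<Longrightarrow> c i = 0" "i \<ge> n"
  shows "(exp_deriv_coeffs j ^^ k) c i = 0"
  using assms(2) by (induction k arbitrary: i) (auto simp: assms(1) exp_deriv_coeffs_def)

lemma exp_poly_has_derivative:
  assumes "\<And>j i. i \<ge> n \<Longrightarrow> c j i = 0"
  shows "(exp_poly n q c k has_real_derivative exp_poly n q c (Suc k) x) (at x)"
proof -
  have *: "((\<lambda>x. (\<Sum>i<n. of_int (b i) * x ^ i) * exp (real j * x)) has_real_derivative
         (\<Sum>i<n. of_int (exp_deriv_coeffs j b i) * x ^ i) * exp (real j * x)) (at x)"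
    if "\<And>i. i \<ge> n \<Longrightarrow> b i = 0" for b and j :: nat
  proof -
    define f where "f i = real_of_int (b i) * (real i * x ^ (i - 1))" for i
    \<comment> \<open>The extra term vanishes because \<open>b n = 0\<close>; with it the index can
      be shifted and no coefficient is lost at the top.\<close>
    have "(\<Sum>i<n. f i) = (\<Sum>i<Suc n. f i)" using that[of n] by (simp add: f_def)
    also have "\<dots> = (\<Sum>i<n. f (Suc i))" by (subst sum.lessThan_Suc_shift) (simp add: f_def)
    finally have shift: "(\<Sum>i<n. f i) = (\<Sum>i<n. f (Suc i))" .
    have "((\<lambda>x. (\<Sum>i<n. of_int (b i) * x ^ i) * exp (real j * x)) has_real_derivative
         ((\<Sum>i<n. f i) * exp (real j * x) + (exp (real j * x) * real j) * (\<Sum>i<n. of_int (b i) * x ^ i))) (at x)"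
      unfolding f_def by (auto intro!: derivative_eq_intros simp: mult_ac)
    also have "(\<Sum>i<n. f i) * exp (real j * x) + (exp (real j * x) * real j) * (\<Sum>i<n. of_int (b i) * x ^ i)
      = ((\<Sum>i<n. f (Suc i)) + (\<Sum>i<n. real j * (of_int (b i) * x ^ i))) * exp (real j * x)"
      by (simp add: shift sum_distrib_left algebra_simps)
    also have "(\<Sum>i<n. f (Suc i)) + (\<Sum>i<n. real j * (of_int (b i) * x ^ i)) = (\<Sum>i<n. of_int (exp_deriv_coeffs j b i) * x ^ i)"
      by (simp add: f_def exp_deriv_coeffs_def algebra_simps flip: sum.distrib)
    finally show ?thesis .
  qed
  show ?thesis
    unfolding exp_poly_def funpow.simps o_def
    by (intro DERIV_sum * exp_deriv_coeffs_funpow_eq_0[where n = n]) (auto simp: assms)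
qed

text \<open>With the weights $i!$ differentiation has norm at most $1$, independently of the degree.\<close>

definition fact_norm :: "nat \<Rightarrow> (nat \<Rightarrow> int) \<Rightarrow> int" where
  "fact_norm n c = (\<Sum>i<n. \<bar>c i\<bar> * fact i)"

text \<open>Since (i + 1) i! = (i + 1)!, the derivative part costs a factor 1 and the part j A a
  factor j. With unweighted coefficients each step could cost about n + q, and 2m steps would cost
  n^(2m), too much against m!.\<close>

lemma fact_norm_exp_deriv_coeffs:
  assumes "\<And>i. i \<ge> n \<Longrightarrow> c i = 0"
  shows "fact_norm n (exp_deriv_coeffs j c) \<le> int (Suc j) * fact_norm n c"
proof -
  have "fact_norm n (exp_deriv_coeffs j c) \<le> (\<Sum>i<n. \<bar>c (Suc i)\<bar> * fact (Suc i) + int j * (\<bar>c i\<bar> * fact i))"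
    unfolding fact_norm_def
  proof (intro sum_mono)
    fix i
    have "\<bar>exp_deriv_coeffs j c i\<bar> \<le> int (Suc i) * \<bar>c (Suc i)\<bar> + int j * \<bar>c i\<bar>"
      unfolding exp_deriv_coeffs_def by (rule order_trans[OF abs_triangle_ineq]) (simp add: abs_mult)
    then have "\<bar>exp_deriv_coeffs j c i\<bar> * fact i \<le> (int (Suc i) * \<bar>c (Suc i)\<bar> + int j * \<bar>c i\<bar>) * fact i"
      by (rule mult_right_mono) simp
    then show "\<bar>exp_deriv_coeffs j c i\<bar> * fact i \<le> \<bar>c (Suc i)\<bar> * fact (Suc i) + int j * (\<bar>c i\<bar> * fact i)"
      by (simp add: algebra_simps)
  qed
  also have "\<dots> = (\<Sum>i<n. \<bar>c (Suc i)\<bar> * fact (Suc i)) + int j * fact_norm n c"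
    by (simp add: sum.distrib fact_norm_def sum_distrib_left)
  also have "(\<Sum>i<n. \<bar>c (Suc i)\<bar> * fact (Suc i)) \<le> fact_norm n c"
  proof -
    have "(\<Sum>i<n. \<bar>c (Suc i)\<bar> * fact (Suc i)) + \<bar>c 0\<bar> * fact 0 = (\<Sum>i<Suc n. \<bar>c i\<bar> * fact i)"
      by (subst sum.lessThan_Suc_shift) simp
    also have "\<dots> = fact_norm n c" using assms[of n] by (simp add: fact_norm_def)
    finally show ?thesis by simp
  qed
  finally show ?thesis by (simp add: algebra_simps)
qed

lemma fact_norm_funpow_exp_deriv_coeffs:
  assumes "\<And>i. i \<ge> n \<Longrightarrow> c i = 0" "j < q"
  shows "fact_norm n ((exp_deriv_coeffs j ^^ k) c) \<le> int q ^ k * fact_norm n c"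
proof (induction k)
  case (Suc k)
  have nn: "0 \<le> fact_norm n c'" for c' by (simp add: fact_norm_def sum_nonneg)
  have "fact_norm n ((exp_deriv_coeffs j ^^ Suc k) c) \<le> int (Suc j) * fact_norm n ((exp_deriv_coeffs j ^^ k) c)"
    unfolding funpow.simps o_def by (intro fact_norm_exp_deriv_coeffs exp_deriv_coeffs_funpow_eq_0[where n = n]) (auto simp: assms)
  also have "\<dots> \<le> int q * (int q ^ k * fact_norm n c)"
    using assms(2) nn by (intro mult_mono Suc) auto
  finally show ?case by simp
qed simp

lemma sum_abs_le_fact_norm: "(\<Sum>i<n. \<bar>c i\<bar>) \<le> fact_norm n c"
  unfolding fact_norm_def by (intro sum_mono) (simp add: mult_le_cancel_left1)

text \<open>Linearity turns the vanishing of derivatives at 0 into a homogeneous integer system for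
  the unknown coefficients.\<close>

lemma funpow_exp_deriv_coeffs_linear:
  "finite S \<Longrightarrow> (exp_deriv_coeffs j ^^ k) (\<lambda>l. \<Sum>i\<in>S. x i * e i l) = (\<lambda>l. \<Sum>i\<in>S. x i * (exp_deriv_coeffs j ^^ k) (e i) l)"
  by (induction k) (auto simp: exp_deriv_coeffs_def sum_distrib_left sum.distrib algebra_simps)

text \<open>All exponentials are 1 at 0, so the derivatives there are integers: this gives Siegel's
  system its integer entries and makes the first nonzero derivative at least 1 in absolute
  value.\<close>

lemma exp_poly_at_0:
  assumes "n \<ge> 1"
  shows "exp_poly n q c k 0 = of_int (\<Sum>j<q. (exp_deriv_coeffs j ^^ k) (c j) 0)"
proof -
  have "(\<Sum>i<n. of_int ((exp_deriv_coeffs j ^^ k) (c j) i) * (0::real) ^ i) = of_int ((exp_deriv_coeffs j ^^ k) (c j) 0)" for j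
    using assms by (subst sum.remove[of _ 0]) auto
  then show ?thesis by (simp add: exp_poly_def)
qed

lemma exp_poly_coeff_bound:
  fixes W :: real
  assumes "\<And>j i. i \<ge> n \<Longrightarrow> c j i = 0" and W: "real_of_int (\<Sum>j<q. fact_norm n (c j)) \<le> W"
  shows "(\<Sum>i<n. \<Sum>j<q. \<bar>real_of_int ((exp_deriv_coeffs j ^^ k) (c j) i)\<bar>) \<le> real q ^ k * W"
proof -
  have "(\<Sum>i<n. \<Sum>j<q. \<bar>(exp_deriv_coeffs j ^^ k) (c j) i\<bar>) = (\<Sum>j<q. \<Sum>i<n. \<bar>(exp_deriv_coeffs j ^^ k) (c j) i\<bar>)"
    by (rule sum.swap)
  also have "\<dots> \<le> (\<Sum>j<q. int q ^ k * fact_norm n (c j))"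
    using assms by (intro sum_mono order_trans[OF sum_abs_le_fact_norm] fact_norm_funpow_exp_deriv_coeffs) auto
  also have "\<dots> = int q ^ k * (\<Sum>j<q. fact_norm n (c j))" by (simp add: sum_distrib_left)
  finally have "real_of_int (\<Sum>i<n. \<Sum>j<q. \<bar>(exp_deriv_coeffs j ^^ k) (c j) i\<bar>) \<le> real_of_int (int q ^ k * (\<Sum>j<q. fact_norm n (c j)))"
    by (subst of_int_le_iff)
  also have "\<dots> = real q ^ k * real_of_int (\<Sum>j<q. fact_norm n (c j))" by simp
  also have "\<dots> \<le> real q ^ k * W" using W by (intro mult_left_mono) auto
  finally show ?thesis by simp
qed

lemma exp_poly_bound:
  fixes W \<rho> :: real
  assumes "\<And>j i. i \<ge> n \<Longrightarrow> c j i = 0" and W: "real_of_int (\<Sum>j<q. fact_norm n (c j)) \<le> W"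
    and x: "\<bar>x\<bar> \<le> \<rho>"
  shows "\<bar>exp_poly n q c k x\<bar> \<le> real q ^ k * W * exp \<rho> ^ (n + q)"
proof -
  have \<rho>: "\<rho> \<ge> 0" using x by simp
  have "\<bar>exp_poly n q c k x\<bar> = \<bar>\<Sum>j<q. \<Sum>i<n. of_int ((exp_deriv_coeffs j ^^ k) (c j) i) * (x ^ i * exp (real j * x))\<bar>"
    by (simp add: exp_poly_def sum_distrib_right mult.assoc)
  also have "\<dots> = \<bar>\<Sum>i<n. \<Sum>j<q. of_int ((exp_deriv_coeffs j ^^ k) (c j) i) * (x ^ i * exp (real j * x))\<bar>"
    by (subst sum.swap) simp
  also have "\<dots> \<le> (\<Sum>i<n. \<Sum>j<q. \<bar>of_int ((exp_deriv_coeffs j ^^ k) (c j) i) * (x ^ i * exp (real j * x))\<bar>)"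
    by (rule order_trans[OF sum_abs]) (intro sum_mono sum_abs)
  also have "\<dots> \<le> (\<Sum>i<n. \<Sum>j<q. \<bar>of_int ((exp_deriv_coeffs j ^^ k) (c j) i)\<bar> * exp \<rho> ^ (n + q))"
  proof (intro sum_mono)
    fix i j assume ij: "i \<in> {..<n}" "j \<in> {..<q}"
    \<comment> \<open>This bounds powers of \<open>x\<close> and exponentials by powers of the same
      base.\<close>
    have "\<bar>x\<bar> \<le> exp \<rho>" using x exp_ge_add_one_self[of \<rho>] by linarith
    then have "\<bar>x\<bar> ^ i \<le> exp \<rho> ^ i" by (intro power_mono) auto
    also have "\<dots> \<le> exp \<rho> ^ n" using ij \<rho> by (intro power_increasing) auto
    finally have 1: "\<bar>x\<bar> ^ i \<le> exp \<rho> ^ n" .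
    have "real j * x \<le> real j * \<rho>" using x by (intro mult_left_mono) auto
    also have "\<dots> \<le> real q * \<rho>" using ij \<rho> by (intro mult_right_mono) auto
    finally have "real j * x \<le> real q * \<rho>" .
    then have 2: "exp (real j * x) \<le> exp \<rho> ^ q" by (simp flip: exp_of_nat_mult)
    have "\<bar>x\<bar> ^ i * exp (real j * x) \<le> exp \<rho> ^ n * exp \<rho> ^ q" using 1 2 by (intro mult_mono) auto
    then show "\<bar>of_int ((exp_deriv_coeffs j ^^ k) (c j) i) * (x ^ i * exp (real j * x))\<bar> \<le> \<bar>of_int ((exp_deriv_coeffs j ^^ k) (c j) i)\<bar> * exp \<rho> ^ (n + q)"
      by (simp add: abs_mult power_abs power_add mult_left_mono)
  qed
  also have "\<dots> = (\<Sum>i<n. \<Sum>j<q. \<bar>real_of_int ((exp_deriv_coeffs j ^^ k) (c j) i)\<bar>) * exp \<rho> ^ (n + q)"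
    by (simp add: sum_distrib_right)
  also have "\<dots> \<le> real q ^ k * W * exp \<rho> ^ (n + q)"
    using exp_poly_coeff_bound[OF assms(1) W] by (intro mult_right_mono) auto
  finally show ?thesis .
qed

lemma fact_quotient_le: "fact t / fact (m + t) \<le> (1 / fact m :: real)"
proof -
  have "fact m * fact t \<le> (fact (m + t) :: real)" by (rule fact_mult_le_fact_add)
  then show ?thesis by (simp add: field_simps)
qed

text \<open>The denominator \<open>fact m\<close> is the gain from the zeros at \<open>a\<close>,
  obtained from t! / (m + t)! <= 1 / m!. The points are kept symmetric because 0 plays both roles in
  the transcendence proof.\<close>

lemma exp_poly_second_zero_bound:
  fixes W \<rho> :: real
  assumes c: "\<And>j i. i \<ge> n \<Longrightarrow> c j i = 0" and W: "real_of_int (\<Sum>j<q. fact_norm n (c j)) \<le> W"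
    and ab: "a \<noteq> b" "\<bar>a\<bar> \<le> \<rho>" "\<bar>b\<bar> \<le> \<rho>"
    and a: "\<And>k. k < m \<Longrightarrow> exp_poly n q c k a = 0" and b: "\<And>k. k < t \<Longrightarrow> exp_poly n q c k b = 0"
  shows "\<bar>exp_poly n q c t b\<bar> \<le> \<bar>b - a\<bar> ^ m * (real q ^ (m + t) * W * exp \<rho> ^ (n + q)) / fact m"
proof -
  obtain \<xi> where \<xi>: "\<xi> \<in> {min a b..max a b}"
    "exp_poly n q c t b = fact t * (b - a) ^ m * exp_poly n q c (m + t) \<xi> / fact (m + t)"
    using value_at_second_zero[where F = "exp_poly n q c" and m = m and t = t, OF exp_poly_has_derivative[OF c] ab(1) a b] by blast
  have "\<bar>\<xi>\<bar> \<le> \<rho>" using \<xi>(1) ab by (auto simp: min_def max_def split: if_splits)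
  have "\<bar>exp_poly n q c t b\<bar> = (fact t / fact (m + t)) * (\<bar>b - a\<bar> ^ m * \<bar>exp_poly n q c (m + t) \<xi>\<bar>)"
    by (simp add: \<xi>(2) abs_mult power_abs)
  also have "\<dots> \<le> (1 / fact m) * (\<bar>b - a\<bar> ^ m * (real q ^ (m + t) * W * exp \<rho> ^ (n + q)))"
    using exp_poly_bound[where n = n and q = q and c = c and k = "m + t" and x = \<xi>, OF c W \<open>\<bar>\<xi>\<bar> \<le> \<rho>\<close>]
    by (intro mult_mono[OF fact_quotient_le] mult_left_mono) auto
  finally show ?thesis by simp
qed

text \<open>If every derivative vanished at 0, the preceding bound with t = 0 and m tending to
  infinity would make the function vanish identically, contradicting the independence of the
  exponentials.\<close>

lemma exp_poly_order_at_0: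
  assumes c: "\<And>j i. i \<ge> n \<Longrightarrow> c j i = 0" and nz: "j < q" "i < n" "c j i \<noteq> 0"
  shows "\<exists>k. exp_poly n q c k 0 \<noteq> 0"
proof (rule ccontr)
  assume "\<not> ?thesis"
  then have 0: "exp_poly n q c k 0 = 0" for k by blast
  define W where "W = real_of_int (\<Sum>j<q. fact_norm n (c j))"
  have zero: "exp_poly n q c 0 x = 0" for x
  proof (cases "x = 0")
    case False
    have "\<bar>exp_poly n q c 0 x\<bar> \<le> \<bar>x - 0\<bar> ^ m * (real q ^ (m + 0) * W * exp \<bar>x\<bar> ^ (n + q)) / fact m" for m
      using False 0 by (intro exp_poly_second_zero_bound c) (auto simp: W_def)
    then have "\<bar>exp_poly n q c 0 x\<bar> \<le> (\<bar>x\<bar> * q) ^ m / fact m * (W * exp \<bar>x\<bar> ^ (n + q))" for m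
      by (simp add: power_mult_distrib mult_ac)
    moreover have "(\<lambda>m. (\<bar>x\<bar> * q) ^ m / fact m * (W * exp \<bar>x\<bar> ^ (n + q))) \<longlonglongrightarrow> 0 * (W * exp \<bar>x\<bar> ^ (n + q))"
      using summable_exp[of "\<bar>x\<bar> * q"] by (intro tendsto_mult tendsto_const summable_LIMSEQ_zero) (simp add: field_simps)
    ultimately have "\<bar>exp_poly n q c 0 x\<bar> \<le> 0 * (W * exp \<bar>x\<bar> ^ (n + q))"
      by (intro LIMSEQ_le_const) auto
    then show ?thesis by simp
  qed (use 0 in simp)
  define P where "P j = (\<Sum>i<n. monom (real_of_int (c j i)) i)" for j
  have "(\<Sum>j<q. poly (P j) x * exp (real j * x)) = 0" for x
    using zero[of x] by (simp add: P_def exp_poly_def poly_sum poly_monom)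
  then have "P j = 0" using nz by (intro exp_poly_independent)
  then have "coeff (P j) i = 0" by simp
  then show False using nz by (simp add: P_def coeff_sum)
qed

text \<open>The n q unknowns are the coefficients of x^i e^(jx). The entries of the system are
  derivatives of these functions at 0, at most B = q^M n! by the weighted norm of a monomial.
  Solutions are at most n q B, and summing n q of them with weights up to n! gives the stated
  bound.\<close>

lemma exp_poly_siegel:
  assumes n: "n \<ge> 1" and q: "q \<ge> 1" and M: "2 * M \<le> n * q"
  obtains c where "\<And>j i. i \<ge> n \<Longrightarrow> c j i = 0" "\<exists>j<q. \<exists>i<n. c j i \<noteq> 0"
    "real_of_int (\<Sum>j<q. fact_norm n (c j)) \<le> real (n * q) ^ 2 * real q ^ M * fact n ^ 2"
    "\<And>t. t < M \<Longrightarrow> exp_poly n q c t 0 = 0"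
proof -
  define e where "e i = (\<lambda>l::nat. if l = i then 1 else 0 :: int)" for i :: nat
  define A where "A t = (\<lambda>(i, j). (exp_deriv_coeffs j ^^ t) (e i) 0)" for t :: nat
  define J where "J = {..<n} \<times> {..<q}"
  define B where "B = q ^ M * fact n"
  have bd: "\<bar>A t p\<bar> \<le> int B" if t: "t \<in> {..<M}" and p: "p \<in> J" for t p
  proof -
    obtain i j where ij: "p = (i, j)" "i < n" "j < q" using p by (auto simp: J_def)
    have "\<bar>A t p\<bar> \<le> (\<Sum>l<n. \<bar>(exp_deriv_coeffs j ^^ t) (e i) l\<bar>)"
      unfolding A_def ij using n by (auto intro!: member_le_sum)
    also have "\<dots> \<le> int q ^ t * fact_norm n (e i)"
      using ij by (intro order_trans[OF sum_abs_le_fact_norm] fact_norm_funpow_exp_deriv_coeffs) (auto simp: e_def)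
    also have "fact_norm n (e i) = (\<Sum>l<n. if l = i then fact i else 0)"
      unfolding fact_norm_def e_def by (intro sum.cong) auto
    also have "\<dots> = fact i" using ij by simp
    also have "int q ^ t * fact i \<le> int q ^ M * fact n"
      using t ij q by (intro mult_mono power_increasing fact_mono) auto
    finally show ?thesis by (simp add: B_def)
  qed
  have "(0, 0) \<in> J" using n q by (simp add: J_def)
  then have "J \<noteq> {}" by blast
  moreover have "1 \<le> B" using q by (simp add: B_def Suc_le_eq)
  ultimately obtain x where x: "\<forall>p\<in>J. \<bar>x p\<bar> \<le> int (card J * B)" "\<exists>p\<in>J. x p \<noteq> 0"
      "\<forall>t\<in>{..<M}. (\<Sum>p\<in>J. A t p * x p) = 0"
    using siegel_int[of "{..<M}" J A B] M bd by (auto simp: J_def)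
  define c where "c j i = (if i < n then x (i, j) else 0)" for j i
  have c: "c j = (\<lambda>l. \<Sum>i<n. x (i, j) * e i l)" for j
  proof
    fix l
    have "(\<Sum>i<n. x (i, j) * e i l) = (\<Sum>i<n. if i = l then x (l, j) else 0)"
      unfolding e_def by (intro sum.cong) auto
    then show "c j l = (\<Sum>i<n. x (i, j) * e i l)" by (simp add: c_def)
  qed
  have z: "exp_poly n q c t 0 = 0" if "t < M" for t
  proof -
    have "(\<Sum>j<q. (exp_deriv_coeffs j ^^ t) (c j) 0) = (\<Sum>j<q. \<Sum>i<n. x (i, j) * (exp_deriv_coeffs j ^^ t) (e i) 0)"
      unfolding c by (subst funpow_exp_deriv_coeffs_linear) auto
    also have "\<dots> = (\<Sum>i<n. \<Sum>j<q. x (i, j) * (exp_deriv_coeffs j ^^ t) (e i) 0)" by (rule sum.swap)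
    also have "\<dots> = (\<Sum>p\<in>J. A t p * x p)"
      unfolding J_def sum.cartesian_product by (intro sum.cong) (auto simp: A_def)
    also have "\<dots> = 0" using x that by auto
    finally show ?thesis using n by (simp add: exp_poly_at_0)
  qed
  have "(\<Sum>j<q. fact_norm n (c j)) \<le> (\<Sum>j<q. \<Sum>i<n. int (card J * B) * fact n)"
    unfolding fact_norm_def
  proof (intro sum_mono mult_mono)
    fix i j assume "i \<in> {..<n}" "j \<in> {..<q}"
    then show "\<bar>c j i\<bar> \<le> int (card J * B)" "fact i \<le> (fact n :: int)"
      using x(1) by (auto simp: c_def J_def intro: fact_mono)
  qed auto
  also have "\<dots> = (int n * int q) ^ 2 * int q ^ M * fact n ^ 2"
    by (simp add: J_def B_def power2_eq_square)
  finally have "real_of_int (\<Sum>j<q. fact_norm n (c j)) \<le> real_of_int ((int n * int q) ^ 2 * int q ^ M * fact n ^ 2)"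
    by (subst of_int_le_iff)
  then have "real_of_int (\<Sum>j<q. fact_norm n (c j)) \<le> real (n * q) ^ 2 * real q ^ M * fact n ^ 2"
    by simp
  moreover have "\<exists>j<q. \<exists>i<n. c j i \<noteq> 0" using x(2) by (auto simp: J_def c_def)
  moreover have "\<And>j i. i \<ge> n \<Longrightarrow> c j i = 0" by (simp add: c_def)
  ultimately show ?thesis using z by (intro that)
qed


theorem hermite_lindemann_real:
  fixes \<alpha> :: real
  assumes "algebraic \<alpha>" "\<alpha> \<noteq> 0"
  shows "\<not> algebraic (exp \<alpha>)"
proof
  assume "algebraic (exp \<alpha>)"
  obtain C :: real and D :: nat where C: "C \<ge> 1" and liouville:
    "\<And>n q K (c :: nat \<Rightarrow> nat \<Rightarrow> int). K \<ge> 1 \<Longrightarrow> (\<Sum>i<n. \<Sum>j<q. \<bar>real_of_int (c i j)\<bar>) \<le> K \<Longrightarrow>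
       (\<Sum>i<n. \<Sum>j<q. of_int (c i j) * \<alpha> ^ i * exp \<alpha> ^ j) \<noteq> 0 \<Longrightarrow>
       1 \<le> \<bar>\<Sum>i<n. \<Sum>j<q. of_int (c i j) * \<alpha> ^ i * exp \<alpha> ^ j\<bar> * (C ^ (n + q) * K) ^ D"
    using liouville_pair[OF assms(1) \<open>algebraic (exp \<alpha>)\<close>] by blast
  define \<rho> where "\<rho> = \<bar>\<alpha>\<bar>"
  \<comment> \<open>Siegel's lemma can impose n q / 2 = n (2D + 3) zeros, which is the threshold of
    \<open>factorial_growth\<close> for the power n!^(2D+2).\<close>
  define q where "q = 2 * (2 * D + 3)"
  \<comment> \<open>Collects all that grows geometrically in m: 4 from n^2 <= 4^m, q^6 from the
    exponents 2m + 1 <= 3m, 2 <= 2m and M <= m, and the exponent 1 + q from n + q <= (1 + q)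
    m.\<close>
  define G where "G = (1 + \<rho>) ^ 2 * (4 * real q ^ 6) * (exp \<rho> * C) ^ (1 + q)"
  have \<rho>: "\<rho> \<ge> 0" "exp \<rho> \<ge> 1" by (auto simp: \<rho>_def)
  have q1: "q \<ge> 1" "real q \<ge> 1" by (auto simp: q_def)
  have "1 * 1 \<le> exp \<rho> * C" using \<rho> C by (intro mult_mono) auto
  then have EC: "1 \<le> exp \<rho> * C" by simp
  have "1 * (1 * 1) * 1 \<le> G"
    unfolding G_def using \<rho> C q1 EC by (intro mult_mono one_le_power) auto
  then have G1: "1 \<le> G" by simp
  obtain n :: nat where n: "n \<ge> 1" and
    growth: "\<And>m. m \<ge> n * ((2 * D + 2) + 1) \<Longrightarrow> (G ^ (D + 1)) ^ m * fact n ^ (2 * D + 2) < fact m"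
    using factorial_growth[OF one_le_power[OF G1, of "D + 1"], of "2 * D + 2"] by blast
  define M where "M = n * (2 * D + 3)"
  have "2 * M \<le> n * q" by (simp add: M_def q_def)
  then obtain c where c: "\<And>j i. i \<ge> n \<Longrightarrow> c j i = 0" and nz: "\<exists>j<q. \<exists>i<n. c j i \<noteq> 0" and
    W: "real_of_int (\<Sum>j<q. fact_norm n (c j)) \<le> real (n * q) ^ 2 * real q ^ M * fact n ^ 2" and
    zeros: "\<And>t. t < M \<Longrightarrow> exp_poly n q c t 0 = 0"
    using exp_poly_siegel[OF n q1(1)] by blast
  define W where "W = real (n * q) ^ 2 * real q ^ M * fact n ^ 2"
  note W' = W[folded W_def]
  have "1 * 1 \<le> real n * real q" using n q1 by (intro mult_mono) auto
  then have "1 \<le> real (n * q)" by simp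
  then have "1 * 1 * 1 \<le> W" unfolding W_def using q1 by (intro mult_mono one_le_power fact_ge_1) auto
  then have W1: "1 \<le> W" by simp
  define m where "m = (LEAST k. exp_poly n q c k 0 \<noteq> 0)"
  have m: "exp_poly n q c m 0 \<noteq> 0"
  proof -
    obtain j i where "j < q" "i < n" "c j i \<noteq> 0" using nz by blast
    then have "\<exists>k. exp_poly n q c k 0 \<noteq> 0" by (intro exp_poly_order_at_0[where n = n and j = j and i = i] c)
    then show ?thesis unfolding m_def by (rule LeastI_ex)
  qed
  have below_m: "exp_poly n q c k 0 = 0" if "k < m" for k
    using not_less_Least[of k "\<lambda>k. exp_poly n q c k 0 \<noteq> 0"] that unfolding m_def by blast
  have Mm: "M \<le> m" using zeros m by (meson not_le)
  have nm: "n \<le> m" using Mm unfolding M_def distrib_left by linarith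
  \<comment> \<open>One majorant for both cases. The exponents m + 1 and 2m + 1 are those met with m
    + 1 zeros at \<alpha>; the factor C^(n+q) lets the same number bound the factor in Liouville's
    inequality.\<close>
  define S where "S = (1 + \<rho>) ^ (m + 1) * (real q ^ (2 * m + 1) * W * exp \<rho> ^ (n + q)) * C ^ (n + q)"
  have S_ge: "x ^ k * (real q ^ t * W * exp \<rho> ^ (n + q)) \<le> S" if "0 \<le> x" "x \<le> \<rho>" "k \<le> m + 1" "t \<le> 2 * m + 1" for x k t
  proof -
    have "x ^ k \<le> (1 + \<rho>) ^ k" using that by (intro power_mono) auto
    also have "\<dots> \<le> (1 + \<rho>) ^ (m + 1)" using that \<rho> by (intro power_increasing) auto
    finally have "x ^ k * (real q ^ t * W * exp \<rho> ^ (n + q)) * 1 \<le> S"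
      unfolding S_def using that \<rho> q1 W1 C by (intro mult_mono power_increasing one_le_power) auto
    then show ?thesis by simp
  qed
  have S1: "1 \<le> S"
  proof -
    have "1 * (1 * 1 * 1) * 1 \<le> S" unfolding S_def using \<rho> q1 W1 C by (intro mult_mono one_le_power) auto
    then show ?thesis by simp
  qed
  have "fact m \<le> S ^ (D + 1)"
  proof (cases "\<exists>t\<le>m. exp_poly n q c t \<alpha> \<noteq> 0")
    case False
    \<comment> \<open>A nonzero integer. The points exchange roles here: \<alpha> carries m + 1
      zeros, 0 carries m, and the value in question is the m-th derivative at 0.\<close>
    have "1 \<le> \<bar>exp_poly n q c m 0\<bar>"
      using m unfolding exp_poly_at_0[OF n] by (metis of_int_1_le_iff of_int_abs of_int_eq_0_iff zero_less_abs_iff int_one_le_iff_zero_less)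
    also have "\<dots> \<le> \<bar>0 - \<alpha>\<bar> ^ (m + 1) * (real q ^ (m + 1 + m) * W * exp \<rho> ^ (n + q)) / fact (m + 1)"
      using assms(2) False below_m by (intro exp_poly_second_zero_bound c W') (auto simp: \<rho>_def)
    also have "\<dots> \<le> S / fact (m + 1)"
      by (intro divide_right_mono S_ge) (auto simp: \<rho>_def)
    finally have "fact (m + 1) \<le> S" by (simp add: field_simps del: fact_Suc)
    moreover have "fact m \<le> (fact (m + 1) :: real)" by (intro fact_mono) auto
    moreover have "S ^ 1 = S" by simp
    moreover have "S ^ 1 \<le> S ^ (D + 1)" using S1 by (intro power_increasing) auto
    ultimately show ?thesis by linarith
  next
    case True
    define t where "t = (LEAST t. exp_poly n q c t \<alpha> \<noteq> 0)"
    have t: "exp_poly n q c t \<alpha> \<noteq> 0" "t \<le> m"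
      using LeastI_ex[of "\<lambda>t. exp_poly n q c t \<alpha> \<noteq> 0"] Least_le[of "\<lambda>t. exp_poly n q c t \<alpha> \<noteq> 0"] True
      unfolding t_def by (blast, metis (lifting) order_trans)
    have below_t: "exp_poly n q c k \<alpha> = 0" if "k < t" for k
      using not_less_Least[of k "\<lambda>t. exp_poly n q c t \<alpha> \<noteq> 0"] that unfolding t_def by blast
    have upper: "\<bar>exp_poly n q c t \<alpha>\<bar> \<le> S / fact m"
    proof -
      have "\<bar>exp_poly n q c t \<alpha>\<bar> \<le> \<bar>\<alpha> - 0\<bar> ^ m * (real q ^ (m + t) * W * exp \<rho> ^ (n + q)) / fact m"
        using assms(2) below_m below_t by (intro exp_poly_second_zero_bound c W') (auto simp: \<rho>_def)
      also have "\<dots> \<le> S / fact m"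
        using t by (intro divide_right_mono S_ge) (auto simp: \<rho>_def)
      finally show ?thesis .
    qed
    have eq: "exp_poly n q c t \<alpha> = (\<Sum>i<n. \<Sum>j<q. of_int ((exp_deriv_coeffs j ^^ t) (c j) i) * \<alpha> ^ i * exp \<alpha> ^ j)"
      unfolding exp_poly_def sum_distrib_right exp_of_nat_mult by (rule sum.swap)
    define K where "K = real q ^ t * W"
    have "1 * 1 \<le> K" unfolding K_def using q1 W1 by (intro mult_mono one_le_power) auto
    then have "1 \<le> \<bar>exp_poly n q c t \<alpha>\<bar> * (C ^ (n + q) * K) ^ D"
      unfolding eq using t(1) exp_poly_coeff_bound[where n = n and q = q and c = c and k = t, OF c W']
      by (intro liouville) (auto simp: K_def eq)
    also have "\<dots> \<le> (S / fact m) * S ^ D"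
    proof (intro mult_mono power_mono upper)
      have "1 * (real q ^ t * W * 1) * C ^ (n + q) \<le> S"
        unfolding S_def using \<rho> q1 W1 C t by (intro mult_mono power_increasing one_le_power) auto
      then show "C ^ (n + q) * K \<le> S" by (simp add: K_def mult.commute)
    qed (use S1 C W1 K_def in auto)
    finally show ?thesis by (simp add: field_simps)
  qed
  also have "S \<le> G ^ m * fact n ^ 2"
  proof -
    have m1: "1 \<le> m" using n nm by simp
    have "real n \<le> 2 ^ n" using of_nat_less_two_power[of n] by (simp add: less_imp_le)
    also have "\<dots> \<le> 2 ^ m" using nm by (intro power_increasing) auto
    finally have "real n ^ 2 \<le> (2 ^ m) ^ 2" by (intro power_mono) auto
    then have n4: "real n ^ 2 \<le> 4 ^ m" by (simp add: power2_eq_square flip: power_mult_distrib)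
    have "W \<le> 4 ^ m * (real q ^ (2 * m) * real q ^ m) * fact n ^ 2"
    proof -
      have "W = real n ^ 2 * (real q ^ 2 * real q ^ M) * fact n ^ 2" by (simp add: W_def power_mult_distrib)
      also have "\<dots> \<le> 4 ^ m * (real q ^ (2 * m) * real q ^ m) * fact n ^ 2"
        using q1 m1 Mm n4 by (intro mult_mono power_increasing) auto
      finally show ?thesis .
    qed
    then have "real q ^ (2 * m + 1) * W \<le> real q ^ (3 * m) * (4 ^ m * (real q ^ (2 * m) * real q ^ m) * fact n ^ 2)"
      using q1 m1 W1 by (intro mult_mono power_increasing) auto
    also have "\<dots> = (4 * real q ^ 6) ^ m * fact n ^ 2"
      by (simp add: power_mult_distrib flip: power_mult power_add)
    finally have 1: "real q ^ (2 * m + 1) * W \<le> (4 * real q ^ 6) ^ m * fact n ^ 2" .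
    have "n + q \<le> (1 + q) * m" using add_mono[OF nm mult_le_mono2[OF m1, of q]]
      by (simp only: mult_1_right distrib_right mult_1)
    then have 2: "(exp \<rho> * C) ^ (n + q) \<le> ((exp \<rho> * C) ^ (1 + q)) ^ m"
      unfolding power_mult[symmetric] using EC by (intro power_increasing)
    have 3: "(1 + \<rho>) ^ (m + 1) \<le> ((1 + \<rho>) ^ 2) ^ m"
      unfolding power_mult[symmetric] using \<rho> m1 by (intro power_increasing) auto
    have "S = (1 + \<rho>) ^ (m + 1) * (real q ^ (2 * m + 1) * W) * (exp \<rho> * C) ^ (n + q)"
      by (simp add: S_def power_mult_distrib)
    also have "\<dots> \<le> ((1 + \<rho>) ^ 2) ^ m * ((4 * real q ^ 6) ^ m * fact n ^ 2) * ((exp \<rho> * C) ^ (1 + q)) ^ m"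
      by (rule mult_mono[OF mult_mono[OF 3 1] 2]) (use \<rho> W1 C q1 in auto)
    also have "\<dots> = G ^ m * fact n ^ 2" by (simp only: G_def power_mult_distrib mult_ac)
    finally show ?thesis .
  qed
  then have "S ^ (D + 1) \<le> (G ^ m * fact n ^ 2) ^ (D + 1)" using S1 by (intro power_mono) auto
  also have "\<dots> = (G ^ (D + 1)) ^ m * fact n ^ (2 * D + 2)"
  proof -
    have "(fact n ^ 2) ^ (D + 1) = (fact n ^ (2 * D + 2) :: real)"
      unfolding power_mult[symmetric] by simp
    moreover have "(G ^ m) ^ (D + 1) = (G ^ (D + 1)) ^ m"
      unfolding power_mult[symmetric] by (simp only: mult.commute)
    ultimately show ?thesis by (simp only: power_mult_distrib)
  qed
  also have "\<dots> < fact m" using Mm by (intro growth) (simp add: M_def algebra_simps)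
  finally show False by simp
qed

subsection \<open>Jensen's formula on the circle\<close>

abbreviation circle_measure :: "real measure" where
  "circle_measure \<equiv> restrict_space lborel {0..2 * pi}"

lemma finite_circle_measure: "finite_measure circle_measure"
  by (intro finite_measureI) (simp add: emeasure_restrict_space space_restrict_space)

lemma cis_measurable [measurable]: "cis \<in> borel_measurable borel"
  by (intro borel_measurable_continuous_onI continuous_intros)

text \<open>The exceptional angles are countable by periodicity. Logarithms of products split only
  away from zeros because \<open>ln 0 = 0\<close>; with this lemma they split almost
  everywhere.\<close>

lemma AE_circle_neq: "AE \<theta> in circle_measure. cis \<theta> \<noteq> c"
proof -
  have "countable {\<theta>. cis \<theta> = c}"
  proof (cases "\<exists>\<theta>0. cis \<theta>0 = c")
    case True
    then obtain \<theta>0 where "cis \<theta>0 = c" by blast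
    then have "{\<theta>. cis \<theta> = c} \<subseteq> range (\<lambda>n::int. \<theta>0 + 2 * pi * of_int n)"
      using sin_cos_eq_iff by (fastforce simp: complex_eq_iff)
    then show ?thesis by (rule countable_subset) auto
  qed auto
  then have "{\<theta>. cis \<theta> = c} \<in> null_sets lborel" by (rule countable_imp_null_set_lborel)
  then have "AE \<theta> in lborel. cis \<theta> \<noteq> c" by (auto dest: AE_not_in)
  then show ?thesis by (subst AE_restrict_space_iff) auto
qed

text \<open>For |u| < 1, log |1 - u| is minus the sum of Re u^n / n. At u = w cis \<theta> every
  term has mean zero over a period, and the geometric majorant in |w| permits integration term by
  term.\<close>

lemma circle_log_inside:
  assumes w: "cmod w < 1"
  shows "has_bochner_integral circle_measure (\<lambda>\<theta>. ln (cmod (1 - w * cis \<theta>))) 0"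
proof -
  interpret finite_measure circle_measure by (rule finite_circle_measure)
  \<comment> \<open>The term for n = 0 is 0, since division by 0 gives 0.\<close>
  define f where "f n \<theta> = - Re ((w * cis \<theta>) ^ n / of_nat n)" for n \<theta>
  have f_le: "\<bar>f n \<theta>\<bar> \<le> cmod w ^ n" for n \<theta>
  proof -
    have "\<bar>f n \<theta>\<bar> \<le> cmod ((w * cis \<theta>) ^ n / of_nat n)"
      unfolding f_def abs_minus_cancel by (rule abs_Re_le_cmod)
    also have "\<dots> = cmod w ^ n / real n" by (simp add: norm_divide norm_power norm_mult)
    also have "\<dots> \<le> cmod w ^ n" 
      using mult_right_mono[of 1 "real n" "cmod w ^ n"] by (cases "n = 0") (auto simp: divide_le_eq mult.commute)
    finally show ?thesis .
  qed
  have meas [measurable]: "f n \<in> borel_measurable circle_measure" for n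
    unfolding f_def by (intro measurable_restrict_space1) measurable
  have int: "integrable circle_measure (f n)" for n
    by (rule integrable_const_bound[where B = "cmod w ^ n"]) (use f_le in auto)
  have zero: "integral\<^sup>L circle_measure (f n) = 0" for n
  proof (cases "n = 0")
    case True
    then show ?thesis by (simp add: f_def[abs_def])
  next
    case False
    \<comment> \<open>An antiderivative of \<open>f n\<close> with period 2 pi, found from De
      Moivre's formula.\<close>
    define F where "F \<theta> = - (Re (w ^ n) * sin (real n * \<theta>) + Im (w ^ n) * cos (real n * \<theta>)) / real n ^ 2" for \<theta>
    have fF: "f n \<theta> = - (Re (w ^ n) * cos (real n * \<theta>) - Im (w ^ n) * sin (real n * \<theta>)) / real n" for \<theta>
      unfolding f_def power_mult_distrib Complex.DeMoivre by (simp add: minus_divide_left)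
    have deriv: "(F has_real_derivative f n \<theta>) (at \<theta>)" for \<theta>
      unfolding F_def fF using False
      by (auto intro!: derivative_eq_intros simp: field_simps power2_eq_square)
    have "integral\<^sup>L lborel (\<lambda>\<theta>. f n \<theta> * indicator {0..2 * pi} \<theta>) = F (2 * pi) - F 0"
    proof (rule integral_FTC_Icc_real)
      show "isCont (f n) \<theta>" for \<theta> unfolding fF by (intro continuous_intros) (use False in auto)
    qed (use deriv in auto)
    also have "F (2 * pi) = F 0"
      using sin_2npi[of n] cos_2npi[of n] by (simp add: F_def mult_ac)
    finally show ?thesis by (simp add: integral_restrict_space mult.commute)
  qed
  have sums: "(\<lambda>n. f n \<theta>) sums ln (cmod (1 - w * cis \<theta>))" for \<theta>
  proof -
    have 1: "cmod (- (w * cis \<theta>)) < 1" using w by (simp add: norm_mult)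
    then have "1 - w * cis \<theta> \<noteq> 0" by auto
    then have "ln (cmod (1 - w * cis \<theta>)) = Re (Ln (1 + - (w * cis \<theta>)))" by simp
    moreover have "(\<lambda>n. Re (- ((w * cis \<theta>) ^ n) / of_nat n)) sums Re (Ln (1 + - (w * cis \<theta>)))"
      using Ln_series'[OF 1] by (intro sums_Re) simp
    ultimately show ?thesis by (simp add: f_def[abs_def])
  qed
  have summ: "summable (\<lambda>n. integral\<^sup>L circle_measure (\<lambda>\<theta>. norm (f n \<theta>)))"
  proof (rule summable_comparison_test)
    have "norm (integral\<^sup>L circle_measure (\<lambda>\<theta>. norm (f n \<theta>))) \<le> cmod w ^ n * (2 * pi)" for n
    proof -
      have "integral\<^sup>L circle_measure (\<lambda>\<theta>. norm (f n \<theta>)) \<le> integral\<^sup>L circle_measure (\<lambda>\<theta>. cmod w ^ n)"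
        using int f_le by (intro integral_mono) auto
      also have "\<dots> = cmod w ^ n * (2 * pi)"
        by (simp add: measure_restrict_space space_restrict_space)
      finally show ?thesis by simp
    qed
    then show "\<exists>N. \<forall>n\<ge>N. norm (integral\<^sup>L circle_measure (\<lambda>\<theta>. norm (f n \<theta>))) \<le> cmod w ^ n * (2 * pi)"
      by blast
    show "summable (\<lambda>n. cmod w ^ n * (2 * pi))" using w by (intro summable_mult2 summable_geometric) auto
  qed
  have abs: "AE \<theta> in circle_measure. summable (\<lambda>n. norm (f n \<theta>))"
    using f_le w by (intro AE_I2 summable_comparison_test[OF _ summable_geometric[of "cmod w"]]) auto
  have "integrable circle_measure (\<lambda>\<theta>. \<Sum>n. f n \<theta>)" "integral\<^sup>L circle_measure (\<lambda>\<theta>. \<Sum>n. f n \<theta>) = (\<Sum>n. integral\<^sup>L circle_measure (f n))"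
    by (rule integrable_suminf[OF int abs summ], rule integral_suminf[OF int abs summ])
  then show ?thesis using sums_unique[OF sums] by (simp add: has_bochner_integral_iff zero)
qed

text \<open>Fatou's lemma along $r w$ with $r \to 1$ gives integrability of the limit; it then dominates, because
  $|1 - u| \le 2 |1 - r u|$ for $|u| = 1$.\<close>

lemma circle_log_unit:
  assumes w: "cmod w = 1"
  shows "has_bochner_integral circle_measure (\<lambda>\<theta>. ln (cmod (1 - w * cis \<theta>))) 0"
proof -
  interpret finite_measure circle_measure by (rule finite_circle_measure)
  define r where "r n = real n / real (Suc n)" for n
  have r: "0 \<le> r n" "r n < 1" for n by (auto simp: r_def)
  have rlim: "r \<longlonglongrightarrow> 1" unfolding r_def by (rule LIMSEQ_n_over_Suc_n)
  define g where "g n \<theta> = ln (cmod (1 - of_real (r n) * w * cis \<theta>))" for n \<theta>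
  define h where "h \<theta> = ln (cmod (1 - w * cis \<theta>))" for \<theta>
  have [measurable]: "g n \<in> borel_measurable circle_measure" "h \<in> borel_measurable circle_measure" for n
    unfolding g_def h_def by (intro measurable_restrict_space1; measurable)+
  have g0: "has_bochner_integral circle_measure (g n) 0" for n
    unfolding g_def using r[of n] w by (intro circle_log_inside) (simp add: norm_mult)
  have nz: "1 - of_real (r n) * w * cis \<theta> \<noteq> 0" for n \<theta>
  proof
    assume "1 - of_real (r n) * w * cis \<theta> = 0"
    then have "cmod (of_real (r n) * w * cis \<theta>) = 1" by (metis eq_iff_diff_eq_0 norm_one)
    then show False using r[of n] w by (simp add: norm_mult)
  qed
  have le2: "cmod (1 - of_real (r n) * w * cis \<theta>) \<le> 2" for n \<theta>
    using norm_triangle_ineq4[of 1 "of_real (r n) * w * cis \<theta>"] r[of n] w by (simp add: norm_mult)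
  have g_le: "g n \<theta> \<le> ln 2" for n \<theta>
    unfolding g_def using le2 nz by (subst ln_le_cancel_iff) auto
  have AE_nz: "AE \<theta> in circle_measure. 1 - w * cis \<theta> \<noteq> 0"
  proof -
    have "w \<noteq> 0" using w by auto
    show ?thesis
      using AE_circle_neq[of "1 / w"] by eventually_elim (use \<open>w \<noteq> 0\<close> in \<open>auto simp: field_simps\<close>)
  qed
  have lim: "AE \<theta> in circle_measure. (\<lambda>n. g n \<theta>) \<longlonglongrightarrow> h \<theta>"
    using AE_nz
  proof eventually_elim
    case (elim \<theta>)
    have "(\<lambda>n. ln (cmod (1 - of_real (r n) * w * cis \<theta>))) \<longlonglongrightarrow> ln (cmod (1 - of_real 1 * w * cis \<theta>))"
      using elim rlim by (intro tendsto_intros) auto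
    then show ?case by (simp add: g_def h_def)
  qed
  have "integrable circle_measure (\<lambda>\<theta>. ln 2 - h \<theta>)"
  proof (rule integrableI_nonneg)
    show "AE \<theta> in circle_measure. 0 \<le> ln 2 - h \<theta>"
      using lim by eventually_elim (use g_le in \<open>auto intro: LIMSEQ_le_const2\<close>)
    have "(\<integral>\<^sup>+\<theta>. ennreal (ln 2 - h \<theta>) \<partial>circle_measure) = (\<integral>\<^sup>+\<theta>. liminf (\<lambda>n. ennreal (ln 2 - g n \<theta>)) \<partial>circle_measure)"
    proof (rule nn_integral_cong_AE)
      show "AE \<theta> in circle_measure. ennreal (ln 2 - h \<theta>) = liminf (\<lambda>n. ennreal (ln 2 - g n \<theta>))"
        using lim
      proof eventually_elim
        case (elim \<theta>)
        have "(\<lambda>n. ennreal (ln 2 - g n \<theta>)) \<longlonglongrightarrow> ennreal (ln 2 - h \<theta>)"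
          by (intro tendsto_ennrealI tendsto_diff tendsto_const elim)
        then show ?case by (metis lim_imp_Liminf trivial_limit_sequentially)
      qed
    qed
    also have "\<dots> \<le> liminf (\<lambda>n. \<integral>\<^sup>+\<theta>. ennreal (ln 2 - g n \<theta>) \<partial>circle_measure)"
      by (rule nn_integral_liminf) measurable
    also have "(\<lambda>n. \<integral>\<^sup>+\<theta>. ennreal (ln 2 - g n \<theta>) \<partial>circle_measure) = (\<lambda>n. ennreal (2 * pi * ln 2))"
    proof
      fix n
      have "integrable circle_measure (g n)" "integral\<^sup>L circle_measure (g n) = 0"
        using g0[of n] by (auto simp: has_bochner_integral_iff)
      then have "(\<integral>\<^sup>+\<theta>. ennreal (ln 2 - g n \<theta>) \<partial>circle_measure) = ennreal (integral\<^sup>L circle_measure (\<lambda>\<theta>. ln 2 - g n \<theta>))"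
        using g_le by (intro nn_integral_eq_integral) auto
      also have "integral\<^sup>L circle_measure (\<lambda>\<theta>. ln 2 - g n \<theta>) = 2 * pi * ln 2"
        using \<open>integrable circle_measure (g n)\<close> \<open>integral\<^sup>L circle_measure (g n) = 0\<close>
        by (simp add: measure_restrict_space space_restrict_space)
      finally show "(\<integral>\<^sup>+\<theta>. ennreal (ln 2 - g n \<theta>) \<partial>circle_measure) = ennreal (2 * pi * ln 2)" .
    qed
    finally show "(\<integral>\<^sup>+\<theta>. ennreal (ln 2 - h \<theta>) \<partial>circle_measure) < \<infinity>"
      by (simp add: Liminf_const le_less_trans)
  qed measurable
  from Bochner_Integration.integrable_diff[OF integrable_const[of "ln 2"] this]
  have inth: "integrable circle_measure h" by simp
  have bound: "AE \<theta> in circle_measure. norm (g n \<theta>) \<le> \<bar>h \<theta>\<bar> + ln 2" for n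
    using AE_nz
  proof eventually_elim
    case (elim \<theta>)
    let ?u = "w * cis \<theta>"
    have "cmod (1 - ?u) \<le> cmod (1 - of_real (r n) * ?u) + cmod (of_real (1 - r n) * ?u)"
      using norm_triangle_ineq4[of "1 - of_real (r n) * ?u" "of_real (1 - r n) * ?u"] by (simp add: algebra_simps)
    also have "cmod (of_real (1 - r n) * ?u) = 1 - r n"
      using r[of n] w by (simp add: norm_mult del: of_real_diff)
    also have "1 - r n \<le> cmod (1 - of_real (r n) * ?u)"
      using norm_triangle_ineq2[of 1 "of_real (r n) * ?u"] r[of n] w by (simp add: norm_mult)
    finally have "cmod (1 - ?u) \<le> 2 * cmod (1 - of_real (r n) * ?u)" by simp
    then have "ln (cmod (1 - ?u)) \<le> ln (2 * cmod (1 - of_real (r n) * ?u))"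
      using elim by (subst ln_le_cancel_iff) (use nz[of n \<theta>] in \<open>auto simp: mult.assoc\<close>)
    also have "\<dots> = ln 2 + g n \<theta>"
      using nz[of n \<theta>] by (subst ln_mult) (auto simp: g_def mult.assoc)
    finally have "h \<theta> \<le> ln 2 + g n \<theta>" by (simp add: h_def)
    then show ?case using g_le[of n \<theta>] unfolding real_norm_def by linarith
  qed
  have "(\<lambda>n. integral\<^sup>L circle_measure (g n)) \<longlonglongrightarrow> integral\<^sup>L circle_measure h"
    using inth lim bound by (intro integral_dominated_convergence[where w = "\<lambda>\<theta>. \<bar>h \<theta>\<bar> + ln 2"]) auto
  moreover have "integral\<^sup>L circle_measure (g n) = 0" for n
    using g0[of n] by (rule has_bochner_integral_integral_eq)
  ultimately have "integral\<^sup>L circle_measure h = 0" by (simp add: LIMSEQ_const_iff)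
  with inth show ?thesis unfolding h_def by (simp add: has_bochner_integral_iff)
qed

text \<open>Factoring out the larger of |z| and |a| leaves 1 - w cis \<theta> with |w| <= 1. The
  radius |z| is kept free: z = 1 gives Jensen's formula, and general z the averages over rotations
  of the disk.\<close>

lemma circle_log:
  assumes "z \<noteq> 0 \<or> a \<noteq> 0"
  shows "has_bochner_integral circle_measure (\<lambda>\<theta>. ln (cmod (cis \<theta> * z - a))) (2 * pi * ln (max (cmod z) (cmod a)))"
proof -
  interpret finite_measure circle_measure by (rule finite_circle_measure)
  define m where "m = max (cmod z) (cmod a)"
  have m: "m > 0" using assms by (auto simp: m_def less_max_iff_disj)
  obtain w where w: "cmod w \<le> 1" "\<And>\<theta>. cmod (cis \<theta> * z - a) = m * cmod (1 - w * cis \<theta>)"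
  proof (cases "cmod z \<le> cmod a")
    case True
    then have a: "a \<noteq> 0" "m = cmod a" using assms by (auto simp: m_def)
    show ?thesis
    proof (rule that[of "z / a"])
      show "cmod (z / a) \<le> 1" using True a by (simp add: norm_divide divide_le_eq)
      fix \<theta>
      have "cis \<theta> * z - a = - (a * (1 - z / a * cis \<theta>))" using a by (simp add: field_simps)
      then show "cmod (cis \<theta> * z - a) = m * cmod (1 - z / a * cis \<theta>)"
        by (simp only: norm_minus_cancel norm_mult a)
    qed
  next
    case False
    then have z: "z \<noteq> 0" "m = cmod z" by (auto simp: m_def)
    show ?thesis
    \<comment> \<open>Factoring out cis \<theta> * z leaves the opposite angle; conjugation reverses
      it without changing the modulus.\<close>
    proof (rule that[of "cnj (a / z)"])
      show "cmod (cnj (a / z)) \<le> 1" using False z by (simp add: norm_divide divide_le_eq)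
      fix \<theta>
      have "cis \<theta> * z - a = cis \<theta> * z * cnj (1 - cnj (a / z) * cis \<theta>)"
        using z by (simp add: field_simps cis_cnj flip: cis_inverse)
      then show "cmod (cis \<theta> * z - a) = m * cmod (1 - cnj (a / z) * cis \<theta>)"
        by (simp only: complex_mod_cnj norm_mult z norm_cis mult_1)
    qed
  qed
  have int: "has_bochner_integral circle_measure (\<lambda>\<theta>. ln (cmod (1 - w * cis \<theta>))) 0"
    using w(1) circle_log_inside[of w] circle_log_unit[of w] by (cases "cmod w = 1") auto
  have "has_bochner_integral circle_measure (\<lambda>\<theta>. ln m + ln (cmod (1 - w * cis \<theta>))) (2 * pi * ln m + 0)"
    by (intro has_bochner_integral_add int)
       (simp add: has_bochner_integral_iff measure_restrict_space space_restrict_space)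
  moreover have "AE \<theta> in circle_measure. ln m + ln (cmod (1 - w * cis \<theta>)) = ln (cmod (cis \<theta> * z - a))"
  proof (cases "w = 0")
    case False
    show ?thesis using AE_circle_neq[of "1 / w"]
    proof eventually_elim
      case (elim \<theta>)
      then have "1 - w * cis \<theta> \<noteq> 0" using False by (auto simp: field_simps)
      then show ?case using m by (simp add: w ln_mult)
    qed
  qed (simp add: w)
  ultimately show ?thesis
    unfolding m_def[symmetric]
    by (subst (asm) has_bochner_integral_cong_AE) (auto simp: has_bochner_integral_iff intro!: measurable_restrict_space1)
qed

subsection \<open>Logarithmic potential of the disk\<close>

lemma Complex_measurable [measurable]:
  "f \<in> borel_measurable M \<Longrightarrow> g \<in> borel_measurable M \<Longrightarrow> (\<lambda>x. Complex (f x) (g x)) \<in> borel_measurable M"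
  by (simp add: borel_measurable_complex_iff)

text \<open>Agreement on boxes determines Lebesgue measure. The product form opens the way to
  Tonelli in the coordinates.\<close>

lemma lborel_complex_eq:
  "(lborel :: complex measure) = distr (lborel \<Otimes>\<^sub>M lborel) borel (\<lambda>(x, y). Complex x y)"
proof (rule lborel_eqI)
  fix l u :: complex
  assume le: "\<And>b. b \<in> Basis \<Longrightarrow> l \<bullet> b \<le> u \<bullet> b"
  have le': "Re l \<le> Re u" "Im l \<le> Im u" using le[of 1] le[of \<i>] by (auto simp: Basis_complex_def inner_complex_def)
  have "emeasure (distr (lborel \<Otimes>\<^sub>M lborel) borel (\<lambda>(x, y). Complex x y)) (box l u) =
      emeasure (lborel \<Otimes>\<^sub>M lborel) ({Re l<..<Re u} \<times> {Im l<..<Im u})"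
    by (subst emeasure_distr) (auto intro!: arg_cong2[where f = emeasure] simp: box_def Basis_complex_def inner_complex_def space_pair_measure)
  also have "\<dots> = ennreal (Re u - Re l) * ennreal (Im u - Im l)"
    using le' by (subst lborel.emeasure_pair_measure_Times) auto
  also have "\<dots> = ennreal (\<Prod>b\<in>Basis. (u - l) \<bullet> b)"
    using le' by (simp add: Basis_complex_def inner_complex_def ennreal_mult')
  finally show "emeasure (distr (lborel \<Otimes>\<^sub>M lborel) borel (\<lambda>(x, y). Complex x y)) (box l u) = ennreal (\<Prod>b\<in>Basis. (u - l) \<bullet> b)" .
qed simp

lemma nn_integral_lborel_complex:
  assumes [measurable]: "f \<in> borel_measurable borel"
  shows "(\<integral>\<^sup>+z. f z \<partial>lborel) = (\<integral>\<^sup>+y. \<integral>\<^sup>+x. f (Complex x y) \<partial>lborel \<partial>lborel)"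
proof -
  have "(\<integral>\<^sup>+z. f z \<partial>lborel) = (\<integral>\<^sup>+p. f (case p of (x, y) \<Rightarrow> Complex x y) \<partial>(lborel \<Otimes>\<^sub>M lborel))"
    unfolding lborel_complex_eq by (subst nn_integral_distr) auto
  also have "\<dots> = (\<integral>\<^sup>+y. \<integral>\<^sup>+x. f (Complex x y) \<partial>lborel \<partial>lborel)"
    by (subst lborel_pair.nn_integral_snd[symmetric]) auto
  finally show ?thesis .
qed

lemma nn_integral_lborel_complex':
  assumes [measurable]: "f \<in> borel_measurable borel"
  shows "(\<integral>\<^sup>+z. f z \<partial>lborel) = (\<integral>\<^sup>+x. \<integral>\<^sup>+y. f (Complex x y) \<partial>lborel \<partial>lborel)"
  unfolding nn_integral_lborel_complex[OF assms]
  by (rule lborel_pair.Fubini'[of "\<lambda>x y. f (Complex x y)"]) measurable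

lemma nn_integral_lborel_affine:
  fixes c :: real
  assumes "f \<in> borel_measurable borel" "c \<noteq> 0"
  shows "(\<integral>\<^sup>+x. f (t + c * x) \<partial>lborel) = ennreal (1 / \<bar>c\<bar>) * (\<integral>\<^sup>+x. f x \<partial>lborel)"
proof -
  have "ennreal (1 / \<bar>c\<bar>) * (\<integral>\<^sup>+x. f x \<partial>lborel) = ennreal (1 / \<bar>c\<bar>) * (ennreal \<bar>c\<bar> * (\<integral>\<^sup>+x. f (t + c * x) \<partial>lborel))"
    using nn_integral_real_affine[OF assms(1,2), of t] by simp
  also have "\<dots> = ennreal (1 / \<bar>c\<bar> * \<bar>c\<bar>) * (\<integral>\<^sup>+x. f (t + c * x) \<partial>lborel)"
    by (simp only: ennreal_mult'' abs_ge_zero mult.assoc)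
  finally show ?thesis using assms by simp
qed

text \<open>For cos \<theta> nonzero the rotation is a succession of one-dimensional affine
  substitutions: u = c x - s y for fixed y, then a substitution in y for fixed u, with scale factors
  1/|c| and |c| that cancel. For cos \<theta> = 0 it exchanges the coordinates up to signs.\<close>

lemma nn_integral_lborel_rotate:
  assumes [measurable]: "f \<in> borel_measurable borel"
  shows "(\<integral>\<^sup>+z. f (cis \<theta> * z) \<partial>lborel) = (\<integral>\<^sup>+z. f z \<partial>lborel)"
proof -
  define c s where "c = cos \<theta>" and "s = sin \<theta>"
  have cs: "c ^ 2 + s ^ 2 = 1" by (simp add: c_def s_def)
  have [measurable]: "(\<lambda>z. f (cis \<theta> * z)) \<in> borel_measurable borel" by measurable
  have mult: "cis \<theta> * Complex x y = Complex (c * x - s * y) (s * x + c * y)" for x y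
    by (simp add: complex_eq_iff c_def s_def)
  show ?thesis
  proof (cases "c = 0")
    case False
    have "(\<integral>\<^sup>+z. f (cis \<theta> * z) \<partial>lborel) = (\<integral>\<^sup>+y. \<integral>\<^sup>+x. f (Complex (c * x - s * y) (s * x + c * y)) \<partial>lborel \<partial>lborel)"
      by (simp add: nn_integral_lborel_complex mult)
    also have "\<dots> = (\<integral>\<^sup>+y. \<integral>\<^sup>+x. (\<lambda>u. f (Complex u (s / c * u + 1 / c * y))) (- s * y + c * x) \<partial>lborel \<partial>lborel)"
    proof (intro nn_integral_cong)
      fix x y
      have "s / c * (- s * y + c * x) + 1 / c * y = s * x + (1 - s ^ 2) / c * y"
        using False by (simp add: field_simps power2_eq_square)
      also have "(1 - s ^ 2) / c = c" using cs False by (simp add: field_simps power2_eq_square)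
      finally show "f (Complex (c * x - s * y) (s * x + c * y)) = (\<lambda>u. f (Complex u (s / c * u + 1 / c * y))) (- s * y + c * x)"
        by (simp add: algebra_simps)
    qed
    also have "\<dots> = (\<integral>\<^sup>+y. ennreal (1 / \<bar>c\<bar>) * (\<integral>\<^sup>+u. f (Complex u (s / c * u + 1 / c * y)) \<partial>lborel) \<partial>lborel)"
      using False by (subst nn_integral_lborel_affine) auto
    also have "\<dots> = ennreal (1 / \<bar>c\<bar>) * (\<integral>\<^sup>+y. \<integral>\<^sup>+u. f (Complex u (s / c * u + 1 / c * y)) \<partial>lborel \<partial>lborel)"
      by (rule nn_integral_cmult) measurable
    also have "(\<integral>\<^sup>+y. \<integral>\<^sup>+u. f (Complex u (s / c * u + 1 / c * y)) \<partial>lborel \<partial>lborel) =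
        (\<integral>\<^sup>+u. \<integral>\<^sup>+y. f (Complex u (s / c * u + 1 / c * y)) \<partial>lborel \<partial>lborel)"
      by (rule lborel_pair.Fubini'[of "\<lambda>u y. f (Complex u (s / c * u + 1 / c * y))"]) measurable
    also have "\<dots> = (\<integral>\<^sup>+u. ennreal \<bar>c\<bar> * (\<integral>\<^sup>+y. f (Complex u y) \<partial>lborel) \<partial>lborel)"
    proof (intro nn_integral_cong)
      fix u
      show "(\<integral>\<^sup>+y. f (Complex u (s / c * u + 1 / c * y)) \<partial>lborel) = ennreal \<bar>c\<bar> * (\<integral>\<^sup>+y. f (Complex u y) \<partial>lborel)"
        using nn_integral_lborel_affine[of "\<lambda>y. f (Complex u y)" "1 / c" "s / c * u"] False by simp
    qed
    also have "\<dots> = ennreal \<bar>c\<bar> * (\<integral>\<^sup>+u. \<integral>\<^sup>+y. f (Complex u y) \<partial>lborel \<partial>lborel)"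
      by (rule nn_integral_cmult) measurable
    also have "ennreal (1 / \<bar>c\<bar>) * (ennreal \<bar>c\<bar> * (\<integral>\<^sup>+u. \<integral>\<^sup>+y. f (Complex u y) \<partial>lborel \<partial>lborel)) =
        ennreal (1 / \<bar>c\<bar> * \<bar>c\<bar>) * (\<integral>\<^sup>+u. \<integral>\<^sup>+y. f (Complex u y) \<partial>lborel \<partial>lborel)"
      by (simp only: ennreal_mult'' abs_ge_zero mult.assoc)
    also have "\<dots> = (\<integral>\<^sup>+z. f z \<partial>lborel)"
      using False by (simp add: nn_integral_lborel_complex')
    finally show ?thesis .
  next
    case True
    then have s: "s \<noteq> 0" "\<bar>s\<bar> = 1" using cs by (auto simp: power2_eq_1_iff)
    have "(\<integral>\<^sup>+z. f (cis \<theta> * z) \<partial>lborel) = (\<integral>\<^sup>+y. \<integral>\<^sup>+x. f (Complex (0 + (- s) * y) (0 + s * x)) \<partial>lborel \<partial>lborel)"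
      by (simp add: nn_integral_lborel_complex mult True)
    also have "\<dots> = (\<integral>\<^sup>+y. (\<lambda>u. \<integral>\<^sup>+v. f (Complex u v) \<partial>lborel) (0 + (- s) * y) \<partial>lborel)"
    proof (rule nn_integral_cong)
      fix y
      show "(\<integral>\<^sup>+x. f (Complex (0 + (- s) * y) (0 + s * x)) \<partial>lborel) = (\<lambda>u. \<integral>\<^sup>+v. f (Complex u v) \<partial>lborel) (0 + (- s) * y)"
        using nn_integral_lborel_affine[of "\<lambda>v. f (Complex (0 + (- s) * y) v)" s 0] s by simp
    qed
    also have "\<dots> = (\<integral>\<^sup>+u. \<integral>\<^sup>+v. f (Complex u v) \<partial>lborel \<partial>lborel)"
      using nn_integral_lborel_affine[of "\<lambda>u. \<integral>\<^sup>+v. f (Complex u v) \<partial>lborel" "- s" 0] s by simp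
    finally show ?thesis by (simp add: nn_integral_lborel_complex')
  qed
qed

section \<open>Radial integrals over the disk\<close>

abbreviation disk_measure :: "complex measure" where
  "disk_measure \<equiv> restrict_space lborel (ball 0 1)"

lemma nn_integral_disk_rotate:
  assumes [measurable]: "f \<in> borel_measurable borel"
  shows "(\<integral>\<^sup>+z. f (cis \<theta> * z) \<partial>disk_measure) = (\<integral>\<^sup>+z. f z \<partial>disk_measure)"
proof -
  have [measurable]: "ball (0::complex) 1 \<in> sets borel" by simp
  have "(\<integral>\<^sup>+z. f (cis \<theta> * z) \<partial>disk_measure) = (\<integral>\<^sup>+z. (\<lambda>z. f z * indicator (ball 0 1) z) (cis \<theta> * z) \<partial>lborel)"
    by (subst nn_integral_restrict_space) (auto intro!: nn_integral_cong simp: indicator_def norm_mult)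
  also have "\<dots> = (\<integral>\<^sup>+z. f z * indicator (ball 0 1) z \<partial>lborel)"
    by (rule nn_integral_lborel_rotate) measurable
  finally show ?thesis by (simp add: nn_integral_restrict_space)
qed

text \<open>Replaces polar coordinates: the part of the disk where |z|^2 > x has area pi (1 - x), so
  the squared modulus has constant density on [0, 1].\<close>

lemma distr_disk_norm_square:
  "distr disk_measure borel (\<lambda>z. (cmod z)\<^sup>2) = density lborel (\<lambda>t. ennreal pi * indicator {0..1} t)"
proof (rule measure_eqI_lessThan)
  fix x :: real
  have [measurable]: "(\<lambda>z. (cmod z)\<^sup>2) \<in> borel_measurable disk_measure"
    by (intro measurable_restrict_space1) measurable
  have ball: "emeasure lborel (ball (0::complex) r) = ennreal (pi * r\<^sup>2)" if "r \<ge> 0" for r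
    using that by (simp add: emeasure_ball unit_ball_vol_2)
  have lhs: "emeasure (distr disk_measure borel (\<lambda>z. (cmod z)\<^sup>2)) {x<..} =
      ennreal (if x < 0 then pi else if x < 1 then pi * (1 - x) else 0)"
  proof -
    have "emeasure (distr disk_measure borel (\<lambda>z. (cmod z)\<^sup>2)) {x<..} =
       emeasure lborel {z \<in> ball (0::complex) 1. x < (cmod z)\<^sup>2}"
      by (subst emeasure_distr, measurable, subst emeasure_restrict_space)
         (auto simp: space_restrict_space intro!: arg_cong2[where f = emeasure])
    also have "\<dots> = ennreal (if x < 0 then pi else if x < 1 then pi * (1 - x) else 0)"
    proof (cases "x < 0")
      case True
      then have "{z \<in> ball (0::complex) 1. x < (cmod z)\<^sup>2} = ball 0 1"
        by (auto intro: less_le_trans)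
      then show ?thesis using True ball[of 1] by simp
    next
      case x0: False
      show ?thesis
      proof (cases "x < 1")
        case True
        have iff: "x < (cmod z)\<^sup>2 \<longleftrightarrow> sqrt x < cmod z" for z
          using real_sqrt_less_iff[of x "(cmod z)\<^sup>2"] by simp
        have "{z \<in> ball (0::complex) 1. x < (cmod z)\<^sup>2} = ball 0 1 - cball 0 (sqrt x)"
          unfolding iff by auto
        also have "emeasure lborel \<dots> = emeasure lborel (ball (0::complex) 1) - emeasure lborel (cball (0::complex) (sqrt x))"
          using True x0 emeasure_lborel_cball_finite[of "0::complex" "sqrt x"]
          by (intro emeasure_Diff) (auto simp: cball_subset_ball_iff)
        also have "\<dots> = ennreal pi - ennreal (pi * x)"
          using x0 ball[of 1] by (simp add: emeasure_cball unit_ball_vol_2)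
        also have "\<dots> = ennreal (pi * (1 - x))"
          using x0 by (simp add: ennreal_minus algebra_simps)
        finally show ?thesis using True x0 by simp
      next
        case False
        have less: "(cmod z)\<^sup>2 < 1" if "z \<in> ball 0 1" for z
          using that by (simp add: abs_square_less_1)
        have empty: "{z \<in> ball (0::complex) 1. x < (cmod z)\<^sup>2} = {}"
          using False less by (force simp: not_less)
        show ?thesis unfolding empty using False by simp
      qed
    qed
    finally show ?thesis .
  qed
  then show "emeasure (distr disk_measure borel (\<lambda>z. (cmod z)\<^sup>2)) {x<..} < \<infinity>" by simp
  have "emeasure (density lborel (\<lambda>t. ennreal pi * indicator {0..1} t)) {x<..} =
      (\<integral>\<^sup>+t. ennreal pi * indicator ({0..1} \<inter> {x<..}) t \<partial>lborel)"
    by (subst emeasure_density) (auto intro!: nn_integral_cong simp: indicator_def)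
  also have "\<dots> = ennreal pi * emeasure lborel ({0..1} \<inter> {x<..})"
    by (subst nn_integral_cmult) auto
  also have "{0..1} \<inter> {x<..} = (if x < 0 then {0..1} else {x<..1})" by auto
  also have "ennreal pi * emeasure lborel \<dots> = ennreal (if x < 0 then pi else if x < 1 then pi * (1 - x) else 0)"
    by (auto simp: ennreal_mult')
  finally show "emeasure (distr disk_measure borel (\<lambda>z. (cmod z)\<^sup>2)) {x<..} =
      emeasure (density lborel (\<lambda>t. ennreal pi * indicator {0..1} t)) {x<..}"
    by (simp add: lhs)
qed auto

lemma nn_integral_disk_radial:
  assumes [measurable]: "h \<in> borel_measurable borel"
  shows "(\<integral>\<^sup>+z. h ((cmod z)\<^sup>2) \<partial>disk_measure) = ennreal pi * (\<integral>\<^sup>+t\<in>{0..1}. h t \<partial>lborel)"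
proof -
  have "(\<integral>\<^sup>+z. h ((cmod z)\<^sup>2) \<partial>disk_measure) = (\<integral>\<^sup>+t. h t \<partial>distr disk_measure borel (\<lambda>z. (cmod z)\<^sup>2))"
    by (subst nn_integral_distr) (auto intro!: measurable_restrict_space1)
  also have "\<dots> = (\<integral>\<^sup>+t. ennreal pi * indicator {0..1} t * h t \<partial>lborel)"
    unfolding distr_disk_norm_square by (subst nn_integral_density) auto
  also have "\<dots> = (\<integral>\<^sup>+t. ennreal pi * (h t * indicator {0..1} t) \<partial>lborel)"
    by (intro nn_integral_cong) (simp add: mult_ac)
  also have "\<dots> = ennreal pi * (\<integral>\<^sup>+t\<in>{0..1}. h t \<partial>lborel)"
    by (rule nn_integral_cmult) measurable
  finally show ?thesis .
qed

text \<open>The end point 0 is reached when the antiderivative of the logarithm is used for a root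
  at the origin.\<close>

lemma continuous_on_mult_ln: "continuous_on {0..1} (\<lambda>t::real. t * ln t)"
  unfolding continuous_on_def
proof
  fix x :: real assume x: "x \<in> {0..1}"
  show "((\<lambda>t. t * ln t) \<longlongrightarrow> x * ln x) (at x within {0..1})"
  proof (cases "x = 0")
    case True
    have "((\<lambda>t::real. t * ln t) \<longlongrightarrow> 0) (at_right 0)" by real_asymp
    then show ?thesis using True by (simp add: at_within_Icc_at_right)
  next
    case False
    then show ?thesis using x by (intro tendsto_intros) auto
  qed
qed

text \<open>With t = |z|^2 and s = |a|^2 the subtracted function is log max(|z|, |a|). For s < 1 it
  is constant on [0, s], and the s ln s contributions of the two pieces cancel; what is left is the
  origin of the exponent (|a|^2 - 1) / 2.\<close>

lemma has_integral_ln_max: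
  fixes s c :: real
  assumes "s \<ge> 0"
  shows "((\<lambda>t. c - ln (max t s) / 2) has_integral (c - (if s \<ge> 1 then ln s / 2 else (s - 1) / 2))) {0..1}"
proof (cases "s \<ge> 1")
  case True
  have "((\<lambda>t::real. c - ln s / 2) has_integral (c - ln s / 2) * (1 - 0)) {0..1}"
    using has_integral_const_real[of "c - ln s / 2" 0 1] by simp
  then have "((\<lambda>t. c - ln (max t s) / 2) has_integral (c - ln s / 2) * (1 - 0)) {0..1}"
    by (rule has_integral_eq[rotated]) (use True in \<open>auto simp: max_def\<close>)
  then show ?thesis using True by simp
next
  case False
  have "((\<lambda>t::real. c - ln s / 2) has_integral (c - ln s / 2) * s) {0..s}"
    using has_integral_const_real[of "c - ln s / 2" 0 s] assms by (simp add: mult.commute)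
  then have 1: "((\<lambda>t. c - ln (max t s) / 2) has_integral (c - ln s / 2) * s) {0..s}"
    by (rule has_integral_eq[rotated]) (auto simp: max_def)
  define F where "F t = c * t - (t * ln t - t) / 2" for t
  have "((\<lambda>t. c - ln t / 2) has_integral (F 1 - F s)) {s..1}"
  proof (rule fundamental_theorem_of_calculus_interior)
    show "continuous_on {s..1} F"
      unfolding F_def using assms
      by (intro continuous_intros continuous_on_subset[OF continuous_on_mult_ln]) auto
    fix t assume "t \<in> {s<..<1}"
    then have "t > 0" using assms by auto
    then have "(F has_real_derivative (c - ln t / 2)) (at t)"
      unfolding F_def by (auto intro!: derivative_eq_intros simp: field_simps)
    then show "(F has_vector_derivative (c - ln t / 2)) (at t)"
      by (simp add: has_real_derivative_iff_has_vector_derivative)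
  qed (use False in auto)
  then have 2: "((\<lambda>t. c - ln (max t s) / 2) has_integral (F 1 - F s)) {s..1}"
    by (rule has_integral_eq[rotated]) (auto simp: max_def)
  have "((\<lambda>t. c - ln (max t s) / 2) has_integral ((c - ln s / 2) * s + (F 1 - F s))) {0..1}"
    using False assms by (intro has_integral_combine[OF _ _ 1 2]) auto
  moreover have "(c - ln s / 2) * s + (F 1 - F s) = c - (s - 1) / 2"
    by (simp add: F_def field_simps)
  ultimately show ?thesis using False by simp
qed

lemma finite_disk_measure: "finite_measure disk_measure"
proof (rule finite_measureI)
  have "emeasure disk_measure (space disk_measure) = emeasure lborel (ball (0::complex) 1)"
    by (simp add: emeasure_restrict_space space_restrict_space)
  also have "\<dots> < \<infinity>" by (rule emeasure_lborel_ball_finite)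
  finally show "emeasure disk_measure (space disk_measure) \<noteq> \<infinity>" by simp
qed

lemma AE_disk_neq: "AE z in disk_measure. z \<noteq> a"
  using AE_lborel_singleton[of a] by (subst AE_restrict_space_iff) auto

lemma disk_log_radial:
  "(\<integral>\<^sup>+z. ennreal (ln (1 + cmod a) - ln (max (cmod z) (cmod a))) \<partial>disk_measure) =
     ennreal (pi * (ln (1 + cmod a) - (if cmod a \<ge> 1 then ln (cmod a) else ((cmod a)\<^sup>2 - 1) / 2)))"
proof -
  define c where "c = ln (1 + cmod a)"
  define s where "s = (cmod a)\<^sup>2"
  define V where "V = (if s \<ge> 1 then ln s / 2 else (s - 1) / 2)"
  define h where "h t = c - ln (max t s) / 2" for t
  have sq: "ln (max ((cmod z)\<^sup>2) s) / 2 = ln (max (cmod z) (cmod a))" for z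
  proof -
    have "max ((cmod z)\<^sup>2) s = (max (cmod z) (cmod a))\<^sup>2"
      unfolding s_def max_def by (auto simp: power_mono_iff)
    then show ?thesis
      by (cases "max (cmod z) (cmod a) > 0") (auto simp: ln_realpow max_def split: if_splits)
  qed
  have nonneg: "0 \<le> h t" if "t \<in> {0..1}" for t
  proof (cases "max t s > 0")
    case True
    have "t \<le> 1" using that by simp
    also have "1 \<le> (1 + cmod a)\<^sup>2" by (rule one_le_power) simp
    finally have "t \<le> (1 + cmod a)\<^sup>2" .
    moreover have "s \<le> (1 + cmod a)\<^sup>2" unfolding s_def by (intro power_mono) auto
    ultimately have "max t s \<le> (1 + cmod a)\<^sup>2" by (rule max.boundedI)
    then have "ln (max t s) \<le> ln ((1 + cmod a)\<^sup>2)" using True by (subst ln_le_cancel_iff) (auto simp: add_pos_nonneg)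
    also have "\<dots> = 2 * c" by (simp add: c_def ln_realpow add_pos_nonneg)
    finally show ?thesis by (simp add: h_def)
  next
    case False
    then have "max t s = 0" using that by (auto simp: max_def s_def split: if_splits)
    then show ?thesis by (simp add: h_def c_def)
  qed
  have s0: "s \<ge> 0" by (simp add: s_def)
  have [measurable]: "h \<in> borel_measurable borel" unfolding h_def by measurable
  have "(\<integral>\<^sup>+z. ennreal (c - ln (max (cmod z) (cmod a))) \<partial>disk_measure) = (\<integral>\<^sup>+z. ennreal (h ((cmod z)\<^sup>2)) \<partial>disk_measure)"
    by (simp add: h_def sq)
  also have "\<dots> = ennreal pi * (\<integral>\<^sup>+t\<in>{0..1}. ennreal (h t) \<partial>lborel)"
    by (rule nn_integral_disk_radial) measurable
  also have "(\<integral>\<^sup>+t\<in>{0..1}. ennreal (h t) \<partial>lborel) = (\<integral>\<^sup>+t. ennreal (if t \<in> {0..1} then h t else 0) \<partial>lborel)"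
    by (intro nn_integral_cong) auto
  also have "\<dots> = ennreal (c - V)"
  proof (rule nn_integral_has_integral_lborel)
    show "((\<lambda>t. if t \<in> {0..1} then h t else 0) has_integral (c - V)) UNIV"
      unfolding has_integral_restrict_UNIV h_def V_def by (rule has_integral_ln_max[OF s0])
  qed (use nonneg in auto)
  also have "ennreal pi * ennreal (c - V) = ennreal (pi * (c - V))" by (simp add: ennreal_mult')
  also have "V = (if cmod a \<ge> 1 then ln (cmod a) else ((cmod a)\<^sup>2 - 1) / 2)"
  proof -
    have "s \<ge> 1 \<longleftrightarrow> cmod a \<ge> 1" using abs_square_less_1[of "cmod a"] by (simp add: s_def flip: not_less)
    moreover have "ln s / 2 = ln (cmod a)" if "cmod a \<ge> 1" using that by (simp add: s_def ln_realpow)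
    ultimately show ?thesis by (auto simp: V_def s_def)
  qed
  finally show ?thesis by (simp only: c_def)
qed

text \<open>By rotation invariance and Tonelli, $\log |z - a|$ may be replaced by its average over rotations of
  \<open>z\<close>, which is the radial function $\log \max(|z|, |a|)$.\<close>

lemma disk_log:
  "has_bochner_integral disk_measure (\<lambda>z. ln (cmod (z - a)))
     (pi * (if cmod a \<ge> 1 then ln (cmod a) else ((cmod a)\<^sup>2 - 1) / 2))"
proof -
  interpret circ: finite_measure circle_measure by (rule finite_circle_measure)
  interpret disk: finite_measure disk_measure by (rule finite_disk_measure)
  interpret pair_sigma_finite circle_measure disk_measure ..
  define c where "c = ln (1 + cmod a)"
  define V where "V = (if cmod a \<ge> 1 then ln (cmod a) else ((cmod a)\<^sup>2 - 1) / 2)"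
  \<comment> \<open>\<open>c\<close> bounds ln |z - a| on the disk, so \<open>g\<close> is truncated
    nowhere there and Tonelli applies before integrability is known.\<close>
  define g where "g z = ennreal (c - ln (cmod (z - a)))" for z
  have c0: "c \<ge> 0" by (simp add: c_def)
  have [measurable]: "g \<in> borel_measurable borel" unfolding g_def by measurable
  have le_c: "ln (cmod (z - a)) \<le> c" if "cmod z < 1" for z
  proof (cases "z = a")
    case False
    have "cmod (z - a) \<le> 1 + cmod a" using norm_triangle_ineq4[of z a] that by linarith
    then show ?thesis unfolding c_def using False by (subst ln_le_cancel_iff) (auto simp: add_pos_nonneg)
  qed (use c0 in simp)
  have circle: "(\<integral>\<^sup>+\<theta>. g (cis \<theta> * z) \<partial>circle_measure) = ennreal (2 * pi) * ennreal (c - ln (max (cmod z) (cmod a)))"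
    if "z \<noteq> 0" "cmod z < 1" for z
  proof -
    have int: "has_bochner_integral circle_measure (\<lambda>\<theta>. c - ln (cmod (cis \<theta> * z - a))) (2 * pi * c - 2 * pi * ln (max (cmod z) (cmod a)))"
      using that(1) by (intro has_bochner_integral_diff circle_log)
        (simp_all add: has_bochner_integral_iff measure_restrict_space space_restrict_space)
    have "(\<integral>\<^sup>+\<theta>. g (cis \<theta> * z) \<partial>circle_measure) = ennreal (2 * pi * c - 2 * pi * ln (max (cmod z) (cmod a)))"
      unfolding g_def has_bochner_integral_integral_eq[OF int, symmetric]
      using that le_c by (intro nn_integral_eq_integral integrable.intros[OF int]) (auto simp: norm_mult)
    also have "\<dots> = ennreal (2 * pi * (c - ln (max (cmod z) (cmod a))))" by (simp add: algebra_simps)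
    also have "\<dots> = ennreal (2 * pi) * ennreal (c - ln (max (cmod z) (cmod a)))" by (rule ennreal_mult') simp
    finally show ?thesis .
  qed
  let ?N = "circle_measure \<Otimes>\<^sub>M disk_measure"
  have "fst \<in> borel_measurable ?N"
    by (rule measurable_compose[OF measurable_fst measurable_restrict_space1]) simp
  then have 1: "(\<lambda>p. cis (fst p)) \<in> borel_measurable ?N"
    by (rule measurable_compose[OF _ cis_measurable])
  have 2: "snd \<in> borel_measurable ?N"
    by (rule measurable_compose[OF measurable_snd measurable_restrict_space1]) simp
  have "(\<lambda>p. g (cis (fst p) * snd p)) \<in> borel_measurable ?N"
    by (rule measurable_compose[OF borel_measurable_times[OF 1 2] \<open>g \<in> borel_measurable borel\<close>])
  then have meas: "(\<lambda>(\<theta>, z). g (cis \<theta> * z)) \<in> borel_measurable ?N"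
    by (simp add: case_prod_beta)
  have "ennreal (2 * pi) * (\<integral>\<^sup>+z. g z \<partial>disk_measure) = (\<integral>\<^sup>+\<theta>. \<integral>\<^sup>+z. g z \<partial>disk_measure \<partial>circle_measure)"
    by (simp add: emeasure_restrict_space space_restrict_space mult.commute)
  also have "\<dots> = (\<integral>\<^sup>+\<theta>. \<integral>\<^sup>+z. g (cis \<theta> * z) \<partial>disk_measure \<partial>circle_measure)"
    by (subst nn_integral_disk_rotate) auto
  also have "\<dots> = (\<integral>\<^sup>+z. \<integral>\<^sup>+\<theta>. g (cis \<theta> * z) \<partial>circle_measure \<partial>disk_measure)"
    by (rule Fubini'[OF meas, symmetric])
  also have "\<dots> = (\<integral>\<^sup>+z. ennreal (2 * pi) * ennreal (c - ln (max (cmod z) (cmod a))) \<partial>disk_measure)"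
  proof (rule nn_integral_cong_AE)
    have "AE z in disk_measure. cmod z < 1" by (intro AE_I2) (simp add: space_restrict_space)
    with AE_disk_neq[of 0] show "AE z in disk_measure. (\<integral>\<^sup>+\<theta>. g (cis \<theta> * z) \<partial>circle_measure) =
        ennreal (2 * pi) * ennreal (c - ln (max (cmod z) (cmod a)))"
      by eventually_elim (rule circle)
  qed
  also have "\<dots> = ennreal (2 * pi) * (\<integral>\<^sup>+z. ennreal (c - ln (max (cmod z) (cmod a))) \<partial>disk_measure)"
    by (intro nn_integral_cmult measurable_restrict_space1) measurable
  also have "(\<integral>\<^sup>+z. ennreal (c - ln (max (cmod z) (cmod a))) \<partial>disk_measure) = ennreal (pi * (c - V))"
    unfolding c_def V_def by (rule disk_log_radial)
  finally have nn: "(\<integral>\<^sup>+z. g z \<partial>disk_measure) = ennreal (pi * (c - V))"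
    by (simp add: ennreal_mult_cancel_left)
  have "V \<le> c"
  proof (cases "cmod a \<ge> 1")
    case True
    then have "ln (cmod a) \<le> ln (1 + cmod a)" by (subst ln_le_cancel_iff) auto
    then show ?thesis using True by (simp add: V_def c_def)
  next
    case False
    then have "(cmod a)\<^sup>2 \<le> 1" using abs_square_le_1[of "cmod a"] by simp
    then show ?thesis using c0 False by (simp add: V_def)
  qed
  then have "has_bochner_integral disk_measure (\<lambda>z. c - ln (cmod (z - a))) (pi * (c - V))"
    using nn le_c unfolding g_def
    by (intro has_bochner_integral_nn_integral AE_I2 measurable_restrict_space1) (auto simp: space_restrict_space)
  moreover have "has_bochner_integral disk_measure (\<lambda>z. c) (pi * c)"
    by (simp add: has_bochner_integral_iff measure_restrict_space space_restrict_space content_ball unit_ball_vol_2)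
  ultimately have "has_bochner_integral disk_measure (\<lambda>z. c - (c - ln (cmod (z - a)))) (pi * c - pi * (c - V))"
    by (intro has_bochner_integral_diff)
  then show ?thesis unfolding V_def[symmetric] by (simp add: algebra_simps)
qed

subsection \<open>Areal Mahler measure\<close>

lemma AE_prod_list_neq_0:
  fixes f :: "'a \<Rightarrow> complex"
  assumes "\<And>a. AE x in M. f x \<noteq> a"
  shows "AE x in M. (\<Prod>a\<leftarrow>as. f x - a) \<noteq> 0"
proof (induction as)
  case (Cons a as)
  with assms[of a] show ?case by eventually_elim auto
qed auto

lemma borel_measurable_prod_list [measurable]:
  fixes f :: "'a \<Rightarrow> complex"
  assumes [measurable]: "f \<in> borel_measurable M"
  shows "(\<lambda>x. \<Prod>a\<leftarrow>as. f x - a) \<in> borel_measurable M"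
  by (induction as) auto

text \<open>Stated for a general \<open>f\<close> so as to serve the circle, where \<open>f\<close>
  is \<open>cis\<close>, as well as the disk, where it is the identity.\<close>

lemma has_bochner_integral_log_prod:
  assumes [measurable]: "f \<in> borel_measurable M" and neq: "\<And>a. AE x in M. f x \<noteq> a"
    and int: "\<And>a. a \<in> set as \<Longrightarrow> has_bochner_integral M (\<lambda>x. ln (cmod (f x - a))) (u a)"
  shows "has_bochner_integral M (\<lambda>x. ln (cmod (\<Prod>a\<leftarrow>as. f x - a))) (\<Sum>a\<leftarrow>as. u a)"
  using int
proof (induction as)
  case Nil
  then show ?case by (simp add: has_bochner_integral_zero)
next
  case (Cons a as)
  have "has_bochner_integral M (\<lambda>x. ln (cmod (f x - a)) + ln (cmod (\<Prod>a\<leftarrow>as. f x - a))) (u a + (\<Sum>a\<leftarrow>as. u a))"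
    using Cons by (intro has_bochner_integral_add) auto
  moreover have "AE x in M. ln (cmod (f x - a)) + ln (cmod (\<Prod>a\<leftarrow>as. f x - a)) = ln (cmod (\<Prod>a\<leftarrow>a # as. f x - a))"
    using neq[of a] AE_prod_list_neq_0[OF neq, of as] by eventually_elim (simp add: norm_mult ln_mult)
  ultimately show ?case
    by (subst (asm) has_bochner_integral_cong_AE) auto
qed

lemma has_bochner_integral_log_poly:
  assumes "finite_measure M" and [measurable]: "f \<in> borel_measurable M" and neq: "\<And>a. AE x in M. f x \<noteq> a"
    and int: "\<And>a. a \<in> set as \<Longrightarrow> has_bochner_integral M (\<lambda>x. ln (cmod (f x - a))) (u a)"
    and p: "\<And>z. poly p z = c * (\<Prod>a\<leftarrow>as. z - a)" and c: "c \<noteq> 0"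
  shows "has_bochner_integral M (\<lambda>x. ln (cmod (poly p (f x)))) (measure M (space M) * ln (cmod c) + (\<Sum>a\<leftarrow>as. u a))"
proof -
  interpret finite_measure M by fact
  have [measurable]: "poly q \<in> borel_measurable borel" for q :: "complex poly"
    by (intro borel_measurable_continuous_onI continuous_intros)
  have "has_bochner_integral M (\<lambda>x. ln (cmod c) + ln (cmod (\<Prod>a\<leftarrow>as. f x - a))) (measure M (space M) * ln (cmod c) + (\<Sum>a\<leftarrow>as. u a))"
    by (intro has_bochner_integral_add has_bochner_integral_log_prod neq int) (auto simp: has_bochner_integral_iff)
  moreover have "AE x in M. ln (cmod c) + ln (cmod (\<Prod>a\<leftarrow>as. f x - a)) = ln (cmod (poly p (f x)))"
    using AE_prod_list_neq_0[OF neq, of as] by eventually_elim (simp add: p norm_mult ln_mult c)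
  ultimately show ?thesis by (subst (asm) has_bochner_integral_cong_AE) auto
qed

lemma complex_poly_roots_list:
  fixes p :: "complex poly"
  assumes "p \<noteq> 0"
  obtains as where "\<And>z. poly p z = lead_coeff p * (\<Prod>a\<leftarrow>as. z - a)"
proof -
  obtain as where as: "mset as = proots p" by (rule ex_mset[THEN exE])
  have "poly p z = lead_coeff p * (\<Prod>a\<leftarrow>as. z - a)" for z
  proof -
    have "poly p z = poly (smult (lead_coeff p) (\<Prod>x\<in>#proots p. [:-x, 1:])) z"
      by (simp add: complex_poly_decompose_multiset)
    also have "\<dots> = lead_coeff p * (\<Prod>x\<in>#proots p. z - x)"
      by (simp add: poly_prod_mset image_mset.compositionality o_def)
    also have "(\<Prod>x\<in>#proots p. z - x) = (\<Prod>a\<leftarrow>as. z - a)"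
      unfolding as[symmetric] mset_map[symmetric] by (rule prod_mset_prod_list)
    finally show ?thesis .
  qed
  then show ?thesis by (rule that)
qed

lemma exp_sum_list: "exp (\<Sum>a\<leftarrow>as. f a) = (\<Prod>a\<leftarrow>as. exp (f a :: real))"
  by (induction as) (auto simp: exp_add)

lemma mahler_jensen:
  assumes p: "\<And>z. poly p z = c * (\<Prod>a\<leftarrow>as. z - a)" and c: "c \<noteq> 0"
  shows "mahler p = cmod c * (\<Prod>a\<leftarrow>as. max 1 (cmod a))"
proof -
  have "has_bochner_integral circle_measure (\<lambda>\<theta>. ln (cmod (poly p (cis \<theta>))))
      (measure circle_measure (space circle_measure) * ln (cmod c) + (\<Sum>a\<leftarrow>as. 2 * pi * ln (max 1 (cmod a))))"
  proof (rule has_bochner_integral_log_poly[OF finite_circle_measure _ AE_circle_neq _ p c])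
    show "has_bochner_integral circle_measure (\<lambda>\<theta>. ln (cmod (cis \<theta> - a))) (2 * pi * ln (max 1 (cmod a)))" for a
      using circle_log[of 1 a] by simp
  qed (intro measurable_restrict_space1, measurable)
  then have "integral\<^sup>L circle_measure (\<lambda>\<theta>. ln (cmod (poly p (cis \<theta>)))) =
      2 * pi * (ln (cmod c) + (\<Sum>a\<leftarrow>as. ln (max 1 (cmod a))))"
    by (simp add: has_bochner_integral_iff measure_restrict_space space_restrict_space sum_list_const_mult distrib_left)
  then have "mahler p = exp (ln (cmod c) + (\<Sum>a\<leftarrow>as. ln (max 1 (cmod a))))"
    by (simp add: mahler_def set_lebesgue_integral_def integral_restrict_space cis_conv_exp)
  also have "\<dots> = cmod c * (\<Prod>a\<leftarrow>as. max 1 (cmod a))"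
  proof -
    have "exp (ln (max 1 (cmod a))) = max 1 (cmod a)" for a by (rule exp_ln) auto
    then show ?thesis using c by (simp add: exp_add exp_sum_list)
  qed
  finally show ?thesis .
qed

lemma areal_mahler_eq:
  assumes p: "\<And>z. poly p z = c * (\<Prod>a\<leftarrow>as. z - a)" and c: "c \<noteq> 0"
  shows "areal_mahler p = mahler p * exp (\<Sum>a\<leftarrow>as. if cmod a < 1 then ((cmod a)\<^sup>2 - 1) / 2 else 0)"
proof -
  define e where "e a = (if cmod a < 1 then ((cmod a)\<^sup>2 - 1) / 2 else 0)" for a
  have V: "(if cmod a \<ge> 1 then ln (cmod a) else ((cmod a)\<^sup>2 - 1) / 2) = ln (max 1 (cmod a)) + e a" for a
    by (auto simp: e_def max_def)
  have "has_bochner_integral disk_measure (\<lambda>z. ln (cmod (poly p z)))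
      (measure disk_measure (space disk_measure) * ln (cmod c) + (\<Sum>a\<leftarrow>as. pi * (ln (max 1 (cmod a)) + e a)))"
  proof (rule has_bochner_integral_log_poly[OF finite_disk_measure _ AE_disk_neq _ p c])
    show "has_bochner_integral disk_measure (\<lambda>z. ln (cmod (z - a))) (pi * (ln (max 1 (cmod a)) + e a))" for a
      using disk_log[of a] unfolding V .
  qed (intro measurable_restrict_space1, measurable)
  then have "integral\<^sup>L disk_measure (\<lambda>z. ln (cmod (poly p z))) =
      pi * (ln (cmod c) + (\<Sum>a\<leftarrow>as. ln (max 1 (cmod a)) + e a))"
    unfolding sum_list_const_mult distrib_left[of pi "ln (cmod c)"]
    by (simp add: has_bochner_integral_iff measure_restrict_space space_restrict_space content_ball unit_ball_vol_2)
  then have "areal_mahler p = exp (ln (cmod c) + (\<Sum>a\<leftarrow>as. ln (max 1 (cmod a)) + e a))"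
    by (simp add: areal_mahler_def set_lebesgue_integral_def integral_restrict_space)
  also have "\<dots> = cmod c * (\<Prod>a\<leftarrow>as. max 1 (cmod a)) * exp (\<Sum>a\<leftarrow>as. e a)"
  proof -
    have "exp (ln (max 1 (cmod a))) = max 1 (cmod a)" for a by (rule exp_ln) auto
    then have "exp (\<Sum>a\<leftarrow>as. ln (max 1 (cmod a))) = (\<Prod>a\<leftarrow>as. max 1 (cmod a))" by (simp add: exp_sum_list)
    then show ?thesis using c by (simp add: exp_add sum_list_addf)
  qed
  finally show ?thesis unfolding mahler_jensen[OF p c] e_def .
qed

text \<open>The square of the modulus is a times its conjugate, a product of algebraic numbers; a
  square root finishes.\<close>

lemma algebraic_norm:
  fixes a :: complex
  assumes "algebraic a"
  shows "algebraic (cmod a)"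
proof -
  have "algebraic (a * cnj a)" using assms by (intro algebraic_mult algebraic_cnj)
  then have "algebraic (complex_of_real ((cmod a)\<^sup>2))" by (simp only: complex_norm_square)
  then have "algebraic ((cmod a)\<^sup>2)" by (simp only: algebraic_of_real_iff)
  from algebraic_sqrt[OF this] show ?thesis by simp
qed

lemma algebraic_sum_list: "(\<And>a. a \<in> set as \<Longrightarrow> algebraic (f a)) \<Longrightarrow> algebraic (\<Sum>a\<leftarrow>as. f a)"
  by (induction as) (auto intro: algebraic_add)

lemma algebraic_prod_list: "(\<And>a. a \<in> set as \<Longrightarrow> algebraic (f a)) \<Longrightarrow> algebraic (\<Prod>a\<leftarrow>as. f a)"
  by (induction as) (auto intro: algebraic_mult rat_imp_algebraic)

theorem proposition1p5:
  fixes P :: "int poly"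
  assumes "P \<noteq> 0"
  shows
    "((\<exists>z \<in> ball (0::complex) 1. poly (map_poly of_int P) z = 0) \<longrightarrow>
        \<not> algebraic (areal_mahler (map_poly of_int P))) \<and>
     (\<not> (\<exists>z \<in> ball (0::complex) 1. poly (map_poly of_int P) z = 0) \<longrightarrow>
        areal_mahler (map_poly of_int P) = mahler (map_poly of_int P) \<and>
        mahler (map_poly of_int P) = real_of_int \<bar>coeff P 0\<bar> \<and>
        areal_mahler (map_poly of_int P) \<in> \<int>)"
proof -
  define p :: "complex poly" where "p = map_poly of_int P"
  define c where "c = lead_coeff p"
  define e where "e a = (if cmod a < 1 then ((cmod a)\<^sup>2 - 1) / 2 else 0)" for a
  have coeff_p: "coeff p i = of_int (coeff P i)" for i by (simp add: p_def coeff_map_poly)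
  have p0: "p \<noteq> 0" using assms coeff_p by (metis coeff_0 leading_coeff_0_iff of_int_eq_0_iff)
  then have c0: "c \<noteq> 0" by (simp add: c_def)
  obtain as where as: "\<And>z. poly p z = c * (\<Prod>a\<leftarrow>as. z - a)"
    using complex_poly_roots_list[OF p0] unfolding c_def by blast
  have root: "poly p z = 0 \<longleftrightarrow> z \<in> set as" for z
    by (simp add: as c0 prod_list_zero_iff image_iff)
  have mahler: "mahler p = cmod c * (\<Prod>a\<leftarrow>as. max 1 (cmod a))" by (rule mahler_jensen[OF as c0])
  have areal: "areal_mahler p = mahler p * exp (\<Sum>a\<leftarrow>as. e a)"
    unfolding e_def by (rule areal_mahler_eq[OF as c0])
  have transcendental: "\<not> algebraic (areal_mahler p)" if z: "z \<in> ball 0 1" "poly p z = 0" for z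
  proof
    assume alg: "algebraic (areal_mahler p)"
    have alg_norm: "algebraic (cmod a)" if "a \<in> set as" for a
    proof (rule algebraic_norm)
      show "algebraic a" using that root p0 coeff_p by (intro algebraicI[of p]) auto
    qed
    have "algebraic (mahler p)"
      unfolding mahler
    proof (intro algebraic_mult algebraic_prod_list)
      show "algebraic (cmod c)" by (simp add: c_def coeff_p rat_imp_algebraic)
      show "algebraic (max 1 (cmod a))" if "a \<in> set as" for a
        using alg_norm[OF that] by (auto simp: max_def rat_imp_algebraic)
    qed
    moreover have "mahler p \<noteq> 0" by (simp add: mahler_def)
    moreover from this have "exp (\<Sum>a\<leftarrow>as. e a) = areal_mahler p * inverse (mahler p)"
      by (simp add: areal field_simps)
    ultimately have "algebraic (exp (\<Sum>a\<leftarrow>as. e a))"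
      using algebraic_mult[OF alg algebraic_inverse] by simp
    moreover have "algebraic (\<Sum>a\<leftarrow>as. e a)"
    proof (rule algebraic_sum_list)
      fix a assume a: "a \<in> set as"
      have "algebraic ((cmod a * cmod a + (- 1)) * (1 / 2))"
        by (intro algebraic_mult algebraic_add alg_norm a rat_imp_algebraic) auto
      then show "algebraic (e a)" by (simp add: e_def power2_eq_square rat_imp_algebraic)
    qed
    \<comment> \<open>No term is positive, so nothing can cancel the strictly negative term of the
      given root.\<close>
    moreover have "(\<Sum>a\<leftarrow>as. e a) < 0"
    proof -
      have e_le: "e a \<le> 0" for a using abs_square_less_1[of "cmod a"] by (auto simp: e_def)
      then have le: "(\<Sum>a\<leftarrow>bs. e a) \<le> 0" for bs by (induction bs) (auto intro: add_nonpos_nonpos)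
      obtain bs cs where "as = bs @ z # cs" using z root by (metis split_list)
      moreover have "e z < 0" using z abs_square_less_1[of "cmod z"] by (auto simp: e_def)
      ultimately show ?thesis using le[of bs] le[of cs] by simp
    qed
    ultimately show False using hermite_lindemann_real by force
  qed
  have outside: "areal_mahler p = mahler p \<and> mahler p = real_of_int \<bar>coeff P 0\<bar>"
    if "\<not> (\<exists>z \<in> ball 0 1. poly p z = 0)"
  proof
    have big: "cmod a \<ge> 1" if "a \<in> set as" for a
      using \<open>\<not> (\<exists>z \<in> ball 0 1. poly p z = 0)\<close> root that by (auto simp: not_less[symmetric])
    have "e a = 0" if "a \<in> set as" for a using big[OF that] by (simp add: e_def)
    then have "(\<Sum>a\<leftarrow>as. e a) = (\<Sum>a\<leftarrow>as. 0)" by (intro arg_cong[where f = sum_list] map_cong) auto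
    then show "areal_mahler p = mahler p" by (simp add: areal)
    \<comment> \<open>With all roots of modulus at least 1, Jensen's product turns into the modulus
      of the factorisation evaluated at 0.\<close>
    have "(\<Prod>a\<leftarrow>as. max 1 (cmod a)) = (\<Prod>a\<leftarrow>as. cmod (0 - a))"
      using big by (intro arg_cong[where f = prod_list] map_cong) auto
    also have "\<dots> = cmod (\<Prod>a\<leftarrow>as. 0 - a)" by (induction as) (auto simp: norm_mult)
    finally have "mahler p = cmod (poly p 0)" by (simp add: mahler as norm_mult)
    also have "\<dots> = real_of_int \<bar>coeff P 0\<bar>" by (simp add: poly_0_coeff_0 coeff_p)
    finally show "mahler p = real_of_int \<bar>coeff P 0\<bar>" .
  qed
  show ?thesis
    unfolding p_def[symmetric] using transcendental outside by (auto simp del: of_int_abs)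
qed

end
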